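(* Let $\theta_0 > \theta_1 > \theta_2$ and let $\Gamma$ be an $n$-vertex non-bipartite biregular graph in $\mathcal{G}(\theta_0,\theta_1,\theta_2)$ with valency-array $(n_1,n_2;k_1,k_2)$. Then the following hold: (i) The valency partition $\{V_1,V_2\}$ is an equitable partition of $\Gamma$ with quotient matrix $Q = \begin{pmatrix} k_{11} & k_{12} \\ k_{21} & k_{22} \end{pmatrix}$, where $$k_{11} = \frac{\alpha_1\theta_0 - \alpha_2 k_1}{\alpha_1-\alpha_2},\quad k_{12} = \alpha_1\frac{k_1-\theta_0}{\alpha_1-\alpha_2},\quad k_{21} = \alpha_2\frac{\theta_0-k_2}{\alpha_1-\alpha_2},\quad k_{22} = \frac{\alpha_1 k_2 - \alpha_2\theta_0}{\alpha_1-\alpha_2}.$$ (ii) All eigenvalues of $\Gamma$ are integers. (iii) If the matrix $Q$ has eigenvalues $\theta_0$ and $\theta$, then $\alpha_1\alpha_2 = -\theta(\theta'+1)$, where $\{\theta,\theta'\} = \{\theta_1,\theta_2\}$. In particular, if $k_{11}=0$ or $k_{22}=0$ then $\alpha_1\alpha_2 = -\theta_2(\theta_1+1)$. (iv) We have $$n = \frac{(\alpha_1^2+\alpha_1\alpha_2+\alpha_2^2-\theta_0-\theta_1\theta_2)(\theta_0-\theta_1)(\theta_0-\theta_2)}{(\theta_0+\theta_1\theta_2+\alpha_1\alpha_2)\alpha_1\alpha_2},$$ $$n_1 = \frac{(\theta_0-\alpha_2^2+\theta_1\theta_2)(\theta_0-\theta_1)(\theta_0-\theta_2)}{(\theta_0+\theta_1\theta_2+\alpha_1\alpha_2)(\alpha_1-\alpha_2)\alpha_1},$$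 $$n_2 = \frac{(\alpha_1^2-\theta_0-\theta_1\theta_2)(\theta_0-\theta_1)(\theta_0-\theta_2)}{(\theta_0+\theta_1\theta_2+\alpha_1\alpha_2)(\alpha_1-\alpha_2)\alpha_2}.$$ (v) The following conditions are equivalent: (a) $k_{21}=n_1$; (b) $k_{12}=n_2$; (c) $n_1=1$; (d) $\Gamma$ is a cone over a strongly regular graph. (vi) If $n$ is a prime at least $3$, then $\Gamma$ is a cone over a strongly regular graph. (vii) $\alpha_1-1 \leq (\alpha_1-\alpha_2)\alpha_2 \leq \min\{-(\theta_1+1)(\theta_2+1),\ -\theta_1\theta_2\}$, unless $\Gamma$ is a cone over a strongly regular graph.
   Context: All graphs are finite and simple; eigenvalues of a graph are those of its adjacency matrix; valency means degree. For $\theta_0 > \theta_1 > \theta_2$, $\mathcal{G}(\theta_0,\theta_1,\theta_2)$ denotes the set of connected nonregular graphs having precisely three distinct eigenvalues $\theta_0$, $\theta_1$, $\theta_2$. A graph is biregular if it has precisely two distinct valencies $k_1>k_2$; then $V_i$ is the set of vertices of valency $k_i$, $n_i=|V_i|$, the valency partition is $\{V_1,V_2\}$, and the valency-array is $(n_1,n_2;k_1,k_2)$. The quotient matrix of the valency partition has as $(i,j)$ entry $k_{ij}$ the average number of neighbours in $V_j$ of vertices in $V_i$; the partition is equitable if every vertex of $V_i$ has exactly $k_{ij}$ neighbours in $V_j$, for all $i,j$. For a graph in $\mathcal{G}(\theta_0,\theta_1,\theta_2)$ with adjacency matrix $A$, there is a unique positive vector $\alpha$ with $(A-\theta_1 I)(A-\theta_2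 I)=\alpha\alpha^{\top}$; it is an eigenvector for $\theta_0$, and a vertex of valency $k_i$ has $\alpha$-entry $\alpha_i=\sqrt{k_i+\theta_1\theta_2}$. A strongly regular graph is a connected regular graph with constants $\lambda,\mu$ such that every pair of distinct vertices has $\lambda$ common neighbours if adjacent and $\mu$ if non-adjacent. The cone over a graph is obtained by adjoining a new vertex adjacent to all its vertices. *)

theory Defs
  imports "HOL-Analysis.Analysis" "HOL-Library.Disjoint_Sets"
    "HOL-Computational_Algebra.Primes" "Graph_Theory.Digraph_Component"
begin

(* A finite simple graph is a pair_graph of Graph_Theory: a finite symmetric loopfree set of
   arcs, given as ordered pairs of vertices. Both orientations of an edge are arcs, so the
   valency of a vertex is its out_degree. *)

definition neighbours :: "'a pair_pre_digraph \<Rightarrow> 'a \<Rightarrow> 'a set" where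
  "neighbours G v = {w. (v, w) \<in> parcs G}"

definition valency :: "'a pair_pre_digraph \<Rightarrow> 'a \<Rightarrow> nat" where
  "valency G v = out_degree (with_proj G) v"

definition graph_connected :: "'a pair_pre_digraph \<Rightarrow> bool" where
  "graph_connected G \<longleftrightarrow> Digraph_Component.connected (with_proj G)"

definition regular_graph :: "'a pair_pre_digraph \<Rightarrow> bool" where
  "regular_graph G \<longleftrightarrow> (\<exists>k. \<forall>v\<in>pverts G. valency G v = k)"

definition bipartite_graph :: "'a pair_pre_digraph \<Rightarrow> bool" where
  "bipartite_graph G \<longleftrightarrow> (\<exists>X Y. X \<union> Y = pverts G \<and> X \<inter> Y = {} \<and>
     (\<forall>(u, v)\<in>parcs G. (u \<in> X \<and> v \<in> Y) \<or> (u \<in> Y \<and> v \<in> X)))"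

definition strongly_regular :: "'a pair_pre_digraph \<Rightarrow> bool" where
  "strongly_regular G \<longleftrightarrow> pair_graph G \<and> graph_connected G \<and> regular_graph G \<and>
     (\<exists>l m. \<forall>u\<in>pverts G. \<forall>v\<in>pverts G. u \<noteq> v \<longrightarrow>
        card (neighbours G u \<inter> neighbours G v) = (if (u, v) \<in> parcs G then l else m))"

definition cone :: "'a \<Rightarrow> 'a pair_pre_digraph \<Rightarrow> 'a pair_pre_digraph" where
  "cone v H = \<lparr> pverts = insert v (pverts H),
                parcs = parcs H \<union> {v} \<times> pverts H \<union> pverts H \<times> {v} \<rparr>"

definition cone_over_strongly_regular :: "'a pair_pre_digraph \<Rightarrow> bool" where
  "cone_over_strongly_regular G \<longleftrightarrow>
     (\<exists>v H. strongly_regular H \<and> v \<notin> pverts H \<and> G = cone v H)"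

definition matrix_eigenvalues :: "real^'n^'n \<Rightarrow> real set" where
  "matrix_eigenvalues M = {x. \<exists>f. f \<noteq> 0 \<and> M *v f = x *\<^sub>R f}"

(* Rows and columns are indexed by the whole type 'v, so this is the adjacency matrix of G
   only when pverts G = UNIV; for smaller vertex sets it has superfluous zero rows. It is
   symmetric, hence its real eigenvalues are all its eigenvalues. *)
definition adjacency_matrix :: "'v::finite pair_pre_digraph \<Rightarrow> real^'v^'v" where
  "adjacency_matrix G = (\<chi> u v. if (u, v) \<in> parcs G then 1 else 0)"

definition graph_eigenvalues :: "'v::finite pair_pre_digraph \<Rightarrow> real set" where
  "graph_eigenvalues G = matrix_eigenvalues (adjacency_matrix G)"

definition three_eigenvalue_graphs ::
    "real \<Rightarrow> real \<Rightarrow> real \<Rightarrow> 'v::finite pair_pre_digraph set" where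
  "three_eigenvalue_graphs \<theta>0 \<theta>1 \<theta>2 =
     {G. pair_graph G \<and> pverts G = UNIV \<and> graph_connected G \<and> \<not> regular_graph G \<and>
         graph_eigenvalues G = {\<theta>0, \<theta>1, \<theta>2}}"

definition valency_class :: "'a pair_pre_digraph \<Rightarrow> nat \<Rightarrow> 'a set" where
  "valency_class G k = {v \<in> pverts G. valency G v = k}"

(* G is biregular with valency-array (n1, n2; k1, k2). *)
definition biregular_with_array ::
    "'a pair_pre_digraph \<Rightarrow> nat \<Rightarrow> nat \<Rightarrow> nat \<Rightarrow> nat \<Rightarrow> bool" where
  "biregular_with_array G n1 n2 k1 k2 \<longleftrightarrow>
     k1 > k2 \<and> valency G ` pverts G = {k1, k2} \<and>
     n1 = card (valency_class G k1) \<and> n2 = card (valency_class G k2)"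

definition average_neighbours ::
    "'a pair_pre_digraph \<Rightarrow> 'a set \<Rightarrow> 'a set \<Rightarrow> real" where
  "average_neighbours G S T = (\<Sum>v\<in>S. real (card (neighbours G v \<inter> T))) / real (card S)"

definition quotient_matrix ::
    "'a pair_pre_digraph \<Rightarrow> 'a set \<Rightarrow> 'a set \<Rightarrow> real^2^2" where
  "quotient_matrix G V1 V2 =
     vector [vector [average_neighbours G V1 V1, average_neighbours G V1 V2],
             vector [average_neighbours G V2 V1, average_neighbours G V2 V2]]"

definition equitable_partition :: "'a pair_pre_digraph \<Rightarrow> 'a set set \<Rightarrow> bool" where
  "equitable_partition G P \<longleftrightarrow> partition_on (pverts G) P \<and>
     (\<forall>S\<in>P. \<forall>T\<in>P. \<forall>v\<in>S. real (card (neighbours G v \<inter> T)) = average_neighbours G S T)"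

(* The unique positive vector alpha with
   (A - theta1 I)(A - theta2 I) = alpha alpha^T. *)
definition alpha_vector ::
    "'v::finite pair_pre_digraph \<Rightarrow> real \<Rightarrow> real \<Rightarrow> real^'v" where
  "alpha_vector G \<theta>1 \<theta>2 = (THE \<alpha>. (\<forall>v. \<alpha> $ v > 0) \<and>
     (adjacency_matrix G - mat \<theta>1) ** (adjacency_matrix G - mat \<theta>2) =
       (columnvector \<alpha> :: real^1^'v) ** rowvector \<alpha>)"

(* The entry of alpha common to all vertices of valency k, namely sqrt (k + theta1 theta2). *)
definition alpha_entry ::
    "'v::finite pair_pre_digraph \<Rightarrow> real \<Rightarrow> real \<Rightarrow> nat \<Rightarrow> real" where
  "alpha_entry G \<theta>1 \<theta>2 k =
     (THE a. \<forall>v\<in>valency_class G k. alpha_vector G \<theta>1 \<theta>2 $ v = a)"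

end

theory Submission
  imports Defs "HOL-Computational_Algebra.Polynomial"
begin

text \<open>By Perron--Frobenius, \<open>(A - \<theta>1 I)(A - \<theta>2 I)\<close> has rank one and equals \<open>\<alpha> \<alpha>\<^sup>T\<close>, so the number of
  common neighbours of two vertices is \<open>\<alpha>u \<alpha>v\<close>, corrected by \<open>\<theta>1 + \<theta>2\<close> for adjacent vertices.
  Solving \<open>A \<alpha> = \<theta>0 \<alpha>\<close> together with the valencies gives the equitable partition, whose quotient matrix
  has second eigenvalue \<open>\<tau> = - \<theta>1 \<theta>2 - \<alpha>1 \<alpha>2\<close>; counting edges between the classes and computing
  \<open>\<alpha> \<bullet> \<alpha>\<close> gives the class sizes. Integrality follows from integrality of common neighbour counts: the
  only irrational possibility forces a complete bipartite graph. If the classes are completely joined,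
  then \<open>\<tau>\<close> is too small to be an eigenvalue of the graph induced on the first class, which therefore
  is empty, complete or a single vertex; only the last case survives. For prime order, the identity
  \<open>n \<alpha>1 \<alpha>2 = (\<alpha>1\<^sup>2 + \<alpha>1 \<alpha>2 + \<alpha>2\<^sup>2 - \<theta>0 - \<theta>1 \<theta>2) (\<theta>0 - \<tau>')\<close> in integers, with \<open>\<tau>'\<close> the remaining
  eigenvalue, forces such a join.\<close>

section \<open>Symmetric real matrices\<close>

lemma symmetric_matrix_inner:
  fixes A :: "real^'n^'n"
  assumes "transpose A = A"
  shows "x \<bullet> (A *v y) = (A *v x) \<bullet> y"
  by (metis assms dot_lmul_matrix transpose_matrix_vector)

lemma mat_mult_vector:
  fixes x :: "real^'n"
  shows "mat c *v x = c *\<^sub>R x"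
  by (simp add: vec_eq_iff matrix_vector_mult_def mat_def if_distrib[where f="\<lambda>y. y * _"] cong: if_cong)

text \<open>The form \<open>m * (x \<bullet> x) - x \<bullet> (A *v x)\<close> is nonnegative on
  \<open>W\<close> and vanishes at \<open>w\<close>, so \<open>w\<close> is a minimum and the
  gradient there, twice \<open>d\<close>, must be zero.\<close>

lemma psd_zero_imp_kernel:
  fixes A :: "real^'n^'n"
  assumes sym: "transpose A = A" and W: "subspace W" and inv: "\<And>x. x \<in> W \<Longrightarrow> A *v x \<in> W"
    and bound: "\<And>x. x \<in> W \<Longrightarrow> x \<bullet> (A *v x) \<le> m * (x \<bullet> x)"
    and w: "w \<in> W" "w \<bullet> (A *v w) = m * (w \<bullet> w)"
  shows "A *v w = m *\<^sub>R w"
proof -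
  define d where "d = m *\<^sub>R w - A *v w"
  have dW: "d \<in> W"
    unfolding d_def using W inv w(1) by (intro subspace_diff subspace_scale) auto
  define c where "c = m * (d \<bullet> d) - d \<bullet> (A *v d)"
  have c: "c \<ge> 0" using bound[OF dW] by (simp add: c_def)
  have quad: "0 \<le> 2 * t * (d \<bullet> d) + t\<^sup>2 * c" for t
  proof -
    have "w + t *\<^sub>R d \<in> W" using W w(1) dW by (intro subspace_add subspace_scale) auto
    from bound[OF this] have "0 \<le> m * ((w + t *\<^sub>R d) \<bullet> (w + t *\<^sub>R d)) - (w + t *\<^sub>R d) \<bullet> (A *v (w + t *\<^sub>R d))"
      by simp
    also have "\<dots> = (m * (w \<bullet> w) - w \<bullet> (A *v w)) + 2 * t * (m * (w \<bullet> d) - (A *v w) \<bullet> d) + t\<^sup>2 * c"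
      using symmetric_matrix_inner[OF sym, of w d] symmetric_matrix_inner[OF sym, of d w]
      by (simp add: c_def algebra_simps matrix_vector_right_distrib
          matrix_vector_mult_scaleR inner_add_left inner_add_right power2_eq_square inner_commute)
    also have "m * (w \<bullet> d) - (A *v w) \<bullet> d = d \<bullet> d"
      by (simp add: d_def inner_diff_left inner_diff_right inner_commute algebra_simps)
    finally show ?thesis using w(2) by simp
  qed
  have "d \<bullet> d \<le> 0"
  proof (rule ccontr)
    assume "\<not> d \<bullet> d \<le> 0"
    then have D: "d \<bullet> d > 0" by (metis not_le)
    \<comment> \<open>Length of a step from \<open>w\<close> against the gradient. The summand 1
      keeps the denominator positive when \<open>c = 0\<close>.\<close>
    define q where "q = (d \<bullet> d) / (c + 1)"
    have q: "q > 0" "d \<bullet> d = q * (c + 1)" using D c by (auto simp: q_def)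
    have "0 \<le> 2 * (- q) * (q * (c + 1)) + (- q)\<^sup>2 * c" using quad[of "- q"] q(2) by simp
    also have "\<dots> = - (q\<^sup>2 * (c + 2))" by (simp add: algebra_simps power2_eq_square)
    also have "\<dots> < 0" using q(1) c by simp
    finally show False by simp
  qed
  then have "d = 0" by (metis inner_ge_zero inner_eq_zero_iff antisym)
  then show ?thesis by (simp add: d_def)
qed

text \<open>The Rayleigh quotient attains its maximum on the compact unit sphere of
  \<open>W\<close>, and a maximiser is an eigenvector. Invariant subspaces are allowed because the
  next lemma needs an eigenvector inside the range of a polynomial in \<open>A\<close>.\<close>

lemma symmetric_matrix_max_eigenvector:
  fixes A :: "real^'n^'n"
  assumes sym: "transpose A = A" and W: "subspace W" and inv: "\<And>x. x \<in> W \<Longrightarrow> A *v x \<in> W"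
    and nz: "z \<in> W" "z \<noteq> 0"
  obtains m w where "w \<in> W" "w \<noteq> 0" "A *v w = m *\<^sub>R w"
    "\<And>x. x \<in> W \<Longrightarrow> x \<bullet> (A *v x) \<le> m * (x \<bullet> x)"
proof -
  let ?S = "W \<inter> sphere 0 1"
  have "compact ?S" using closed_subspace[OF W] by (intro closed_Int_compact) auto
  moreover have "(1 / norm z) *\<^sub>R z \<in> ?S" using nz W by (auto intro: subspace_scale)
  then have "?S \<noteq> {}" by blast
  moreover have "continuous_on ?S (\<lambda>x. x \<bullet> (A *v x))"
    by (intro continuous_intros matrix_vector_mult_linear_continuous_on)
  ultimately obtain w where w: "w \<in> ?S" "\<And>y. y \<in> ?S \<Longrightarrow> y \<bullet> (A *v y) \<le> w \<bullet> (A *v w)"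
    by (rule continuous_attains_sup[elim_format]) blast
  define m where "m = w \<bullet> (A *v w)"
  have bound: "x \<bullet> (A *v x) \<le> m * (x \<bullet> x)" if "x \<in> W" for x
  proof (cases "x = 0")
    case False
    have "(1 / norm x) *\<^sub>R x \<in> ?S" using that False W by (auto intro: subspace_scale)
    from w(2)[OF this] have "(x \<bullet> (A *v x)) / (norm x)\<^sup>2 \<le> m"
      by (simp add: m_def matrix_vector_mult_scaleR power2_eq_square)
    then show ?thesis using False by (simp add: pos_divide_le_eq power2_norm_eq_inner)
  qed simp
  have "w \<bullet> w = 1" using w(1) by (simp add: norm_eq_1)
  then have "A *v w = m *\<^sub>R w"
    using w(1) by (intro psd_zero_imp_kernel[OF sym W inv bound]) (auto simp: m_def)
  moreover have "w \<noteq> 0" using w(1) by auto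
  ultimately show ?thesis using that w(1) bound by blast
qed

text \<open>Avoids diagonalisation: a nonzero product \<open>P\<close> has an
  \<open>A\<close>-invariant range containing an eigenvector \<open>w\<close>. Its eigenvalue is a
  root, so \<open>P *v w = 0\<close>; as \<open>P\<close> is symmetric, \<open>w\<close> is then
  orthogonal to the range it lies in.\<close>

lemma symmetric_matrix_three_eigenvalues:
  fixes A :: "real^'n^'n"
  assumes sym: "transpose A = A" and ev: "matrix_eigenvalues A \<subseteq> {a, b, c}"
  shows "(A - mat a) ** ((A - mat b) ** (A - mat c)) = 0"
proof -
  define P where "P = (A - mat a) ** ((A - mat b) ** (A - mat c))"
  have app: "P *v x = A *v (A *v (A *v x)) - (a + b + c) *\<^sub>R (A *v (A *v x))
      + (a * b + a * c + b * c) *\<^sub>R (A *v x) - (a * b * c) *\<^sub>R x" for x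
    by (simp add: P_def matrix_vector_mul_assoc[symmetric] matrix_vector_mult_diff_rdistrib
        matrix_vector_mult_diff_distrib mat_mult_vector matrix_vector_mult_scaleR algebra_simps)
  have P: "P *v x = 0" for x
  proof (rule ccontr)
    assume "P *v x \<noteq> 0"
    let ?W = "range ((*v) P)"
    have "subspace ?W" by (rule linear_subspace_image) (auto simp: subspace_UNIV)
    moreover have "A *v y \<in> ?W" if "y \<in> ?W" for y
    proof -
      from that obtain x where x: "y = P *v x" by blast
      have "A *v y = P *v (A *v x)"
        unfolding x app by (simp add: matrix_vector_right_distrib matrix_vector_mult_diff_distrib matrix_vector_mult_scaleR)
      then show ?thesis by blast
    qed
    ultimately obtain m w where w: "w \<in> ?W" "w \<noteq> 0" "A *v w = m *\<^sub>R w"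
      using \<open>P *v x \<noteq> 0\<close> symmetric_matrix_max_eigenvector[OF sym, of ?W "P *v x"] by (metis rangeI)
    have m: "m \<in> {a, b, c}" using w ev by (auto simp: matrix_eigenvalues_def)
    obtain y where y: "w = P *v y" using w(1) by blast
    have "P *v w = ((m - a) * (m - b) * (m - c)) *\<^sub>R w"
      unfolding app by (simp add: w(3) matrix_vector_mult_scaleR algebra_simps)
    then have "P *v w = 0" using m by auto
    moreover have "w \<bullet> (P *v y) = (P *v w) \<bullet> y"
      unfolding app using symmetric_matrix_inner[OF sym]
      by (simp add: inner_add_left inner_add_right inner_diff_left inner_diff_right)
    ultimately show False using w(2) y by simp
  qed
  then show ?thesis unfolding P_def[symmetric] by (subst matrix_eq) simp
qed

section \<open>Graphs with three eigenvalues\<close>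

lemma neighbours_iff: "v \<in> neighbours G u \<longleftrightarrow> (u, v) \<in> parcs G"
  by (simp add: neighbours_def)

lemma valency_eq_card: "valency G v = card (neighbours G v)"
proof -
  have "out_arcs (with_proj G) v = Pair v ` neighbours G v"
    by (auto simp: out_arcs_def neighbours_def)
  then show ?thesis by (simp add: valency_def out_degree_def card_image inj_on_def)
qed

lemma pair_graph_sym:
  assumes "pair_graph G"
  shows "(u, v) \<in> parcs G \<longleftrightarrow> (v, u) \<in> parcs G"
proof -
  interpret pair_graph G by fact
  show ?thesis using pair_sym_arcs by (auto simp: symmetric_def elim: symE)
qed

lemma pair_graph_irrefl:
  assumes "pair_graph G"
  shows "(u, u) \<notin> parcs G"
proof -
  interpret pair_graph G by fact
  show ?thesis using pair_no_loops by fastforce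
qed

lemma pair_graph_in_verts:
  assumes "pair_graph G" "(u, v) \<in> parcs G"
  shows "u \<in> pverts G" "v \<in> pverts G"
proof -
  interpret pair_graph G by fact
  show "u \<in> pverts G" "v \<in> pverts G" using wellformed' assms(2) by auto
qed

lemma pair_graphI:
  assumes "finite (pverts G)" "parcs G \<subseteq> pverts G \<times> pverts G"
    "\<And>u v. (u, v) \<in> parcs G \<Longrightarrow> (v, u) \<in> parcs G" "\<And>u. (u, u) \<notin> parcs G"
  shows "pair_graph G"
proof
  show "finite (parcs G)" using assms(1,2) by (meson finite_SigmaI finite_subset)
  show "symmetric (with_proj G)" using assms(3) by (auto simp: symmetric_def intro: symI)
next
  fix e assume "e \<in> parcs G"
  then show "fst e \<in> pverts G" "snd e \<in> pverts G" "fst e \<noteq> snd e"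
    using assms(2,4) by (cases e; auto)+
qed (fact assms(1))

text \<open>Connectivity as an induction principle: symmetric arcs make the digraph strongly
  connected, so induction along directed walks reaches every vertex.\<close>

lemma graph_connected_closed:
  assumes G: "pair_graph G" "graph_connected G"
    and S: "s \<in> S" "s \<in> pverts G" "\<And>u v. u \<in> S \<Longrightarrow> (u, v) \<in> parcs G \<Longrightarrow> v \<in> S"
  shows "pverts G \<subseteq> S"
proof
  fix v assume v: "v \<in> pverts G"
  interpret pair_graph G by fact
  have "strongly_connected (with_proj G)"
    using G(2) pair_sym_arcs symmetric_connected_imp_strongly_connected
    by (auto simp: graph_connected_def)
  then have "s \<rightarrow>\<^sup>*\<^bsub>with_proj G\<^esub> v" using S(2) v by (auto simp: strongly_connected_def)
  then show "v \<in> S"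
    by (induct rule: reachable_induct) (use S in auto)
qed

lemma graph_connected_iff:
  assumes "pair_graph G"
  shows "graph_connected G \<longleftrightarrow> pverts G \<noteq> {} \<and>
    (\<forall>u\<in>pverts G. \<forall>v\<in>pverts G. reachable (with_proj G) u v)"
proof -
  interpret pair_graph G by fact
  show ?thesis
    unfolding graph_connected_def connected_def strongly_connected_def
    using reachable_mk_symmetric_eq[OF pair_sym_arcs] by simp
qed

lemma adjacency_matrix_nth: "adjacency_matrix G $ u $ v = (if (u, v) \<in> parcs G then 1 else 0)"
  by (simp add: adjacency_matrix_def)

lemma adjacency_matrix_mult_vector:
  "(adjacency_matrix G *v x) $ u = (\<Sum>v\<in>neighbours G u. x $ v)"
  by (simp add: matrix_vector_mult_def adjacency_matrix_nth neighbours_def sum.If_cases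
      if_distrib[where f="\<lambda>y. y * _"] cong: if_cong)

lemma adjacency_matrix_square:
  assumes "pair_graph G"
  shows "(adjacency_matrix G ** adjacency_matrix G) $ u $ v = real (card (neighbours G u \<inter> neighbours G v))"
proof -
  have "(adjacency_matrix G ** adjacency_matrix G) $ u $ v =
      (\<Sum>w\<in>UNIV. if w \<in> neighbours G u \<inter> neighbours G v then 1 else 0)"
    unfolding matrix_matrix_mult_def
    by (auto simp: adjacency_matrix_nth neighbours_def pair_graph_sym[OF assms, of _ v] intro!: sum.cong)
  then show ?thesis by (simp add: sum.If_cases Int_def)
qed

lemma transpose_adjacency_matrix:
  assumes "pair_graph G"
  shows "transpose (adjacency_matrix G) = adjacency_matrix G"
  using pair_graph_sym[OF assms] by (auto simp: vec_eq_iff transpose_def adjacency_matrix_nth)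

section \<open>Perron-Frobenius theory and the rank-one matrix \<open>B\<close>\<close>

locale three_eigenvalue_graph =
  fixes G :: "'v::finite pair_pre_digraph" and \<theta>0 \<theta>1 \<theta>2 :: real
  assumes ord: "\<theta>0 > \<theta>1" "\<theta>1 > \<theta>2" and mem: "G \<in> three_eigenvalue_graphs \<theta>0 \<theta>1 \<theta>2"
begin

abbreviation "A \<equiv> adjacency_matrix G"
abbreviation "N \<equiv> neighbours G"
abbreviation "B \<equiv> (A - mat \<theta>1) ** (A - mat \<theta>2)"
abbreviation "\<alpha> \<equiv> alpha_vector G \<theta>1 \<theta>2"

lemma pg: "pair_graph G" and verts: "pverts G = UNIV" and conn: "graph_connected G"
  and nonreg: "\<not> regular_graph G" and evs: "matrix_eigenvalues A = {\<theta>0, \<theta>1, \<theta>2}"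
  using mem by (auto simp: three_eigenvalue_graphs_def graph_eigenvalues_def)

lemmas adj_sym = pair_graph_sym[OF pg] and adj_irrefl = pair_graph_irrefl[OF pg]
lemmas A_sym = transpose_adjacency_matrix[OF pg]
lemmas A_inner = symmetric_matrix_inner[OF A_sym]

lemma connected_induct:
  assumes "P s" "\<And>u v. P u \<Longrightarrow> (u, v) \<in> parcs G \<Longrightarrow> P v"
  shows "P v"
  using graph_connected_closed[OF pg conn, of s "{v. P v}"] assms verts by blast

text \<open>The maximum of the Rayleigh quotient is itself an eigenvalue, hence at most the largest
  one.\<close>

lemma rayleigh: "x \<bullet> (A *v x) \<le> \<theta>0 * (x \<bullet> x)"
proof -
  from evs obtain f where f: "f \<noteq> 0" "A *v f = \<theta>0 *\<^sub>R f"
    unfolding matrix_eigenvalues_def by blast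
  obtain m w where w: "w \<noteq> 0" "A *v w = m *\<^sub>R w" and m: "\<And>x. x \<bullet> (A *v x) \<le> m * (x \<bullet> x)"
    using symmetric_matrix_max_eigenvector[OF A_sym subspace_UNIV, of f, OF UNIV_I UNIV_I f(1)]
    by (metis UNIV_I)
  have "m \<in> {\<theta>0, \<theta>1, \<theta>2}" using w evs by (auto simp: matrix_eigenvalues_def)
  moreover have "\<theta>0 \<le> m" using m[of f] f by simp
  ultimately show ?thesis using m ord by auto
qed

text \<open>Since \<open>A\<close> has nonnegative entries, passing to absolute values keeps the
  norm and does not decrease the quadratic form, so the Rayleigh bound is attained again.\<close>

lemma abs_eigenvector:
  assumes w: "A *v w = \<theta>0 *\<^sub>R w"
  shows "A *v (\<chi> i. \<bar>w $ i\<bar>) = \<theta>0 *\<^sub>R (\<chi> i. \<bar>w $ i\<bar>)"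
proof -
  let ?u = "\<chi> i. \<bar>w $ i\<bar>"
  have "\<theta>0 * (?u \<bullet> ?u) = w \<bullet> (A *v w)"
    by (simp add: w inner_vec_def sum_distrib_left algebra_simps)
  also have "\<dots> \<le> ?u \<bullet> (A *v ?u)"
    unfolding inner_vec_def adjacency_matrix_mult_vector
  proof (rule sum_mono)
    fix i
    have "w $ i * (\<Sum>v\<in>N i. w $ v) \<le> \<bar>w $ i\<bar> * \<bar>\<Sum>v\<in>N i. w $ v\<bar>"
      by (metis abs_ge_self abs_mult)
    also have "\<dots> \<le> \<bar>w $ i\<bar> * (\<Sum>v\<in>N i. \<bar>w $ v\<bar>)"
      by (intro mult_left_mono sum_abs) simp
    finally show "w $ i \<bullet> (\<Sum>v\<in>N i. w $ v) \<le> ?u $ i \<bullet> (\<Sum>v\<in>N i. ?u $ v)" by simp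
  qed
  finally have "?u \<bullet> (A *v ?u) = \<theta>0 * (?u \<bullet> ?u)" using rayleigh[of ?u] by linarith
  then show ?thesis
    by (intro psd_zero_imp_kernel[OF A_sym subspace_UNIV _ rayleigh]) auto
qed

text \<open>Zeros spread along arcs: at a zero entry, the eigenvalue equation of the absolute values
  says that a sum of nonnegative terms over the neighbours is zero. Connectivity would then force
  \<open>w = 0\<close>.\<close>

lemma eigenvector_nonzero_entry:
  assumes w: "A *v w = \<theta>0 *\<^sub>R w" and "w \<noteq> 0"
  shows "w $ i \<noteq> 0"
proof
  assume 0: "w $ i = 0"
  have "w $ v = 0" for v
  proof (induct rule: connected_induct[of _ i])
    case (2 u v)
    have "(\<Sum>v\<in>N u. \<bar>w $ v\<bar>) = 0"
      using arg_cong[OF abs_eigenvector[OF w], of "\<lambda>x. x $ u"] 2(1)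
      by (simp add: adjacency_matrix_mult_vector)
    then show ?case using 2(2) by (simp add: sum_nonneg_eq_0_iff neighbours_iff)
  qed (fact 0)
  then show False using \<open>w \<noteq> 0\<close> by (simp add: vec_eq_iff)
qed

lemma perron_vector:
  obtains h where "\<And>v. h $ v > 0" "A *v h = \<theta>0 *\<^sub>R h"
    "\<And>x. A *v x = \<theta>0 *\<^sub>R x \<Longrightarrow> \<exists>c. x = c *\<^sub>R h"
proof -
  from evs obtain f where f: "f \<noteq> 0" "A *v f = \<theta>0 *\<^sub>R f"
    unfolding matrix_eigenvalues_def by blast
  define h where "h = (\<chi> i. \<bar>f $ i\<bar>)"
  have h: "h $ v > 0" for v using eigenvector_nonzero_entry[OF f(2,1)] by (simp add: h_def)
  have Ah: "A *v h = \<theta>0 *\<^sub>R h" unfolding h_def by (rule abs_eigenvector[OF f(2)])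
  have "\<exists>c. x = c *\<^sub>R h" if x: "A *v x = \<theta>0 *\<^sub>R x" for x
  proof -
    fix i :: 'v
    \<comment> \<open>The multiple of \<open>h\<close> is chosen to cancel the entry at the
      arbitrary vertex \<open>i\<close>, which forces \<open>y = 0\<close>.\<close>
    define y where "y = x - (x $ i / h $ i) *\<^sub>R h"
    have "A *v y = \<theta>0 *\<^sub>R y"
      by (simp add: y_def matrix_vector_mult_diff_distrib matrix_vector_mult_scaleR x Ah algebra_simps)
    moreover have "y $ i = 0" using h[of i] by (simp add: y_def)
    ultimately have "y = 0" using eigenvector_nonzero_entry by blast
    then show ?thesis by (auto simp: y_def)
  qed
  then show ?thesis using that h Ah by blast
qed

lemma B_mult_vector: "B *v x = A *v (A *v x) - (\<theta>1 + \<theta>2) *\<^sub>R (A *v x) + (\<theta>1 * \<theta>2) *\<^sub>R x"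
  by (simp add: matrix_vector_mul_assoc[symmetric] matrix_vector_mult_diff_rdistrib
        matrix_vector_mult_diff_distrib mat_mult_vector matrix_vector_mult_scaleR algebra_simps)

text \<open>The cubic identity puts the range of \<open>B\<close> into the \<theta>0-eigenspace,
  which is spanned by \<open>h\<close>. Symmetry of \<open>B\<close> then determines the scalar, and
  rescaling \<open>h\<close> absorbs it.\<close>

lemma ex_alpha:
  "\<exists>a. (\<forall>v. a $ v > 0) \<and> A *v a = \<theta>0 *\<^sub>R a \<and> (\<forall>x. B *v x = (a \<bullet> x) *\<^sub>R a)"
proof -
  obtain h where h: "\<And>v. h $ v > 0" "A *v h = \<theta>0 *\<^sub>R h"
    "\<And>x. A *v x = \<theta>0 *\<^sub>R x \<Longrightarrow> \<exists>c. x = c *\<^sub>R h"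
    using perron_vector by blast
  have "h \<noteq> 0" using h(1) by (metis less_irrefl zero_index)
  then have hh: "h \<bullet> h > 0" by simp
  \<comment> \<open>The eigenvalue of \<open>B\<close> at \<open>h\<close>; the scaled vector gets
    squared norm \<open>M\<close>.\<close>
  define M where "M = (\<theta>0 - \<theta>1) * (\<theta>0 - \<theta>2)"
  have M: "M > 0" using ord by (simp add: M_def)
  have Bx: "B *v x = (M / (h \<bullet> h) * (h \<bullet> x)) *\<^sub>R h" for x
  proof -
    have "(A - mat \<theta>0) *v (B *v x) = 0"
      by (metis symmetric_matrix_three_eigenvalues[OF A_sym] evs order_refl
          matrix_vector_mul_assoc matrix_vector_mult_0)
    then have "A *v (B *v x) = \<theta>0 *\<^sub>R (B *v x)"
      by (simp add: matrix_vector_mult_diff_rdistrib mat_mult_vector)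
    then obtain c where c: "B *v x = c *\<^sub>R h" using h(3) by blast
    have "h \<bullet> (B *v x) = (B *v h) \<bullet> x"
      unfolding B_mult_vector using A_inner
      by (simp add: inner_add_left inner_add_right inner_diff_left inner_diff_right)
    also have "B *v h = M *\<^sub>R h"
      by (simp add: B_mult_vector h(2) matrix_vector_mult_scaleR M_def algebra_simps)
    finally have "c = M / (h \<bullet> h) * (h \<bullet> x)" using c hh by (simp add: field_simps)
    then show ?thesis using c by simp
  qed
  define r where "r = sqrt (M / (h \<bullet> h))"
  have r: "r > 0" "r * r = M / (h \<bullet> h)" using M hh by (auto simp: r_def)
  have "B *v x = ((r *\<^sub>R h) \<bullet> x) *\<^sub>R (r *\<^sub>R h)" for x
    unfolding Bx r(2)[symmetric] by (simp add: mult_ac)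
  moreover have "A *v (r *\<^sub>R h) = \<theta>0 *\<^sub>R (r *\<^sub>R h)"
    by (simp add: matrix_vector_mult_scaleR h(2))
  ultimately show ?thesis using h(1) r(1) by (intro exI[of _ "r *\<^sub>R h"]) auto
qed

lemma column_row_nth: "((columnvector a :: real^1^'v) ** rowvector a) $ u $ v = a $ u * a $ v"
  by (simp add: columnvector_def rowvector_def matrix_matrix_mult_def)

text \<open>The diagonal of a rank-one matrix gives the squares of the entries, and positivity gives
  their signs. So the definite description of \<open>\<alpha>\<close> picks out the vector of
  \<open>ex_alpha\<close>.\<close>

lemma
  shows alpha_pos: "\<alpha> $ v > 0" and A_alpha: "A *v \<alpha> = \<theta>0 *\<^sub>R \<alpha>"
    and B_vec: "B *v x = (\<alpha> \<bullet> x) *\<^sub>R \<alpha>" and B_nth: "B $ u $ v = \<alpha> $ u * \<alpha> $ v"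
proof -
  obtain a where a: "\<forall>v. a $ v > 0" "A *v a = \<theta>0 *\<^sub>R a" "\<forall>x. B *v x = (a \<bullet> x) *\<^sub>R a"
    using ex_alpha by blast
  have Bn: "B $ u $ v = a $ u * a $ v" for u v
    using a(3)[rule_format, of "axis v 1"]
    by (simp add: vec_eq_iff matrix_vector_mult_basis column_def inner_axis mult.commute)
  have "\<alpha> = a"
    unfolding alpha_vector_def
  proof (rule the_equality)
    show "(\<forall>v. 0 < a $ v) \<and> B = (columnvector a :: real^1^'v) ** rowvector a"
      using a(1) Bn by (simp add: vec_eq_iff column_row_nth)
    fix b :: "real^'v" assume b: "(\<forall>v. 0 < b $ v) \<and> B = (columnvector b :: real^1^'v) ** rowvector b"
    have "b $ v = a $ v" for v
    proof -
      have "(b $ v)\<^sup>2 = (a $ v)\<^sup>2" using b Bn[of v v] by (simp add: column_row_nth power2_eq_square)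
      then show ?thesis using a(1) b by (simp add: power2_eq_iff_nonneg less_imp_le)
    qed
    then show "b = a" by (simp add: vec_eq_iff)
  qed
  then show "\<alpha> $ v > 0" "A *v \<alpha> = \<theta>0 *\<^sub>R \<alpha>" "B *v x = (\<alpha> \<bullet> x) *\<^sub>R \<alpha>"
    "B $ u $ v = \<alpha> $ u * \<alpha> $ v"
    using a Bn by auto
qed

text \<open>Expands \<open>B\<close> entrywise, with the entries of \<open>A ** A\<close> counting
  walks of length two. All later combinatorial information comes from this identity and from
  \<open>A_alpha\<close>.\<close>

lemma common_neighbours:
  "real (card (N u \<inter> N v)) =
    (if (u, v) \<in> parcs G then \<theta>1 + \<theta>2 else 0) - (if u = v then \<theta>1 * \<theta>2 else 0) + \<alpha> $ u * \<alpha> $ v"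
proof -
  have "B = A ** A - (\<theta>1 + \<theta>2) *\<^sub>R A + (\<theta>1 * \<theta>2) *\<^sub>R mat 1"
    by (subst matrix_eq, unfold B_mult_vector)
       (simp add: matrix_vector_mult_add_rdistrib matrix_vector_mult_diff_rdistrib
        matrix_vector_mul_assoc scaleR_matrix_vector_assoc[symmetric])
  then have "\<alpha> $ u * \<alpha> $ v = (A ** A) $ u $ v - (\<theta>1 + \<theta>2) * A $ u $ v + \<theta>1 * \<theta>2 * (mat 1 $ u $ v)"
    unfolding B_nth[symmetric] by simp
  then show ?thesis
    by (simp add: adjacency_matrix_square[OF pg] adjacency_matrix_nth mat_def split: if_splits)
qed

lemma alpha_square: "(\<alpha> $ v)\<^sup>2 = real (valency G v) + \<theta>1 * \<theta>2"
  using common_neighbours[of v v] adj_irrefl[of v] by (simp add: valency_eq_card power2_eq_square)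

lemma sum_alpha: "(\<Sum>w\<in>N v. \<alpha> $ w) = \<theta>0 * \<alpha> $ v"
  using arg_cong[OF A_alpha, of "\<lambda>x. x $ v"] by (simp add: adjacency_matrix_mult_vector)

lemma alpha_norm: "\<alpha> \<bullet> \<alpha> = (\<theta>0 - \<theta>1) * (\<theta>0 - \<theta>2)"
proof -
  have "(\<alpha> \<bullet> \<alpha>) *\<^sub>R \<alpha> = ((\<theta>0 - \<theta>1) * (\<theta>0 - \<theta>2)) *\<^sub>R \<alpha>"
    by (simp add: B_vec[symmetric] B_mult_vector A_alpha matrix_vector_mult_scaleR algebra_simps)
  moreover have "\<alpha> \<noteq> 0" using alpha_pos by (metis less_irrefl zero_index)
  ultimately show ?thesis by simp
qed

text \<open>\<open>B\<close> vanishes on vectors orthogonal to \<open>\<alpha>\<close>, so \<theta>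
  is a root of its quadratic.\<close>

lemma orthogonal_eigenvalue:
  assumes "A *v w = \<theta> *\<^sub>R w" "w \<noteq> 0" "\<alpha> \<bullet> w = 0"
  shows "\<theta> \<in> {\<theta>1, \<theta>2}"
proof -
  have "0 = B *v w" by (simp add: B_vec assms)
  also have "\<dots> = ((\<theta> - \<theta>1) * (\<theta> - \<theta>2)) *\<^sub>R w"
    by (simp add: B_mult_vector assms matrix_vector_mult_scaleR algebra_simps)
  finally show ?thesis using assms(2) by simp
qed

end

section \<open>Biregular graphs\<close>

text \<open>A rational algebraic integer is an integer. Applied later to the characteristic
  polynomial of the quotient matrix.\<close>

lemma Ints_monic_quadratic_root:
  fixes x :: real
  assumes "x \<in> \<rat>" "t \<in> \<int>" "d \<in> \<int>" "x\<^sup>2 + t * x + d = 0"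
  shows "x \<in> \<int>"
proof -
  have "algebraic_int x"
  proof (rule algebraic_int.intros)
    show "lead_coeff [:d, t, 1:] = 1" by simp
    show "\<forall>i. coeff [:d, t, 1:] i \<in> \<int>" using assms by (auto simp: coeff_pCons split: nat.split)
    show "poly [:d, t, 1:] x = 0" using assms(4) by (simp add: power2_eq_square algebra_simps)
  qed
  then show ?thesis using assms(1) by (rule rational_algebraic_int_is_int)
qed

lemma Ints_pos_ge_1: "x \<in> \<int> \<Longrightarrow> 0 < x \<Longrightarrow> 1 \<le> x" for x :: real
  by (elim Ints_cases) auto

locale biregular_three_eigenvalue_graph = three_eigenvalue_graph +
  fixes n1 n2 k1 k2 :: nat
  assumes biregular: "biregular_with_array G n1 n2 k1 k2"
    and nonbipartite: "\<not> bipartite_graph G"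
begin

abbreviation "V1 \<equiv> valency_class G k1"
abbreviation "V2 \<equiv> valency_class G k2"
abbreviation "a1 \<equiv> alpha_entry G \<theta>1 \<theta>2 k1"
abbreviation "a2 \<equiv> alpha_entry G \<theta>1 \<theta>2 k2"

text \<open>Closed forms only; \<open>class_count\<close> and \<open>average_count\<close> identify
  them with the entries of the quotient matrix.\<close>

definition "q11 = (a1 * \<theta>0 - a2 * real k1) / (a1 - a2)"
definition "q12 = a1 * ((real k1 - \<theta>0) / (a1 - a2))"
definition "q21 = a2 * ((\<theta>0 - real k2) / (a1 - a2))"
definition "q22 = (a1 * real k2 - a2 * \<theta>0) / (a1 - a2)"

section \<open>Valency classes and the equitable partition\<close>

lemma k_less: "k2 < k1" and n1: "n1 = card V1" and n2: "n2 = card V2"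
  and valencies: "range (valency G) = {k1, k2}"
  using biregular verts by (auto simp: biregular_with_array_def)

lemma V_nonempty: "V1 \<noteq> {}" "V2 \<noteq> {}" and V_disjoint: "V1 \<inter> V2 = {}" and V_Un: "V1 \<union> V2 = UNIV"
proof -
  have "valency G v \<in> {k1, k2}" for v unfolding valencies[symmetric] by blast
  then show "V1 \<union> V2 = UNIV" by (auto simp: valency_class_def verts)
  have "k1 \<in> range (valency G)" "k2 \<in> range (valency G)" by (auto simp: valencies)
  then show "V1 \<noteq> {}" "V2 \<noteq> {}" by (auto simp: valency_class_def verts)
  show "V1 \<inter> V2 = {}" using k_less by (auto simp: valency_class_def)
qed

lemma V_cases: "v \<in> V1 \<and> v \<notin> V2 \<or> v \<in> V2 \<and> v \<notin> V1"
  using V_Un V_disjoint by blast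

lemma valency_V: "v \<in> V1 \<Longrightarrow> valency G v = k1" "v \<in> V2 \<Longrightarrow> valency G v = k2"
  by (auto simp: valency_class_def)

lemma n_pos: "n1 > 0" "n2 > 0"
  using V_nonempty by (auto simp: n1 n2 card_gt_0_iff)

lemma n_sum: "n1 + n2 = card (pverts G)"
  using card_Un_disjoint[OF finite finite V_disjoint] by (simp only: n1 n2 verts V_Un)

text \<open>The valency fixes the square of the positive entry, so on an inhabited class the
  description behind \<open>alpha_entry\<close> has exactly one solution.\<close>

lemma alpha_eq_entry:
  assumes "v \<in> valency_class G k"
  shows "\<alpha> $ v = alpha_entry G \<theta>1 \<theta>2 k"
proof -
  have "\<alpha> $ w = \<alpha> $ v" if "w \<in> valency_class G k" for w
  proof -
    have "(\<alpha> $ w)\<^sup>2 = (\<alpha> $ v)\<^sup>2" using that assms by (simp add: alpha_square valency_class_def)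
    then show ?thesis using alpha_pos by (simp add: power2_eq_iff_nonneg less_imp_le)
  qed
  then have "(THE a. \<forall>w\<in>valency_class G k. \<alpha> $ w = a) = \<alpha> $ v"
    using assms by (intro the_equality) (blast, metis)
  then show ?thesis by (simp only: alpha_entry_def)
qed

lemma alpha_V: "v \<in> V1 \<Longrightarrow> \<alpha> $ v = a1" "v \<in> V2 \<Longrightarrow> \<alpha> $ v = a2"
  by (rule alpha_eq_entry, assumption)+

lemma a_pos: "a1 > 0" "a2 > 0"
  and a_square: "a1\<^sup>2 = real k1 + \<theta>1 * \<theta>2" "a2\<^sup>2 = real k2 + \<theta>1 * \<theta>2"
proof -
  obtain u v where uv: "u \<in> V1" "v \<in> V2" using V_nonempty by blast
  show "a1 > 0" "a2 > 0" using alpha_pos[of u] alpha_pos[of v] by (simp_all only: alpha_V uv)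
  show "a1\<^sup>2 = real k1 + \<theta>1 * \<theta>2" "a2\<^sup>2 = real k2 + \<theta>1 * \<theta>2"
    using alpha_square[of u] alpha_square[of v] by (simp_all only: alpha_V valency_V uv)
qed

lemma a_less: "a2 < a1"
  using a_square k_less a_pos by (simp add: power2_less_imp_less)

lemma q_mult:
  "q11 * (a1 - a2) = a1 * \<theta>0 - a2 * real k1" "q12 * (a1 - a2) = a1 * (real k1 - \<theta>0)"
  "q21 * (a1 - a2) = a2 * (\<theta>0 - real k2)" "q22 * (a1 - a2) = a1 * real k2 - a2 * \<theta>0"
  using a_less by (auto simp: q11_def q12_def q21_def q22_def)

lemma card_split: "card S = card (S \<inter> V1) + card (S \<inter> V2)"
proof -
  have "card S = card (S \<inter> V1 \<union> S \<inter> V2)" using V_Un by (simp flip: Int_Un_distrib)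
  then show ?thesis using V_disjoint by (subst (asm) card_Un_disjoint) auto
qed

lemma sum_split: "sum f S = sum f (S \<inter> V1) + sum f (S \<inter> V2)" for f :: "'a \<Rightarrow> real"
proof -
  have "sum f S = sum f (S \<inter> V1 \<union> S \<inter> V2)" using V_Un by (simp flip: Int_Un_distrib)
  then show ?thesis using V_disjoint by (subst (asm) sum.union_disjoint) auto
qed

text \<open>The row of \<open>v\<close> in
  \<open>A *v \<alpha> = \<theta>0 *\<^sub>R \<alpha>\<close> and the valency of \<open>v\<close>
  are two linear equations for the two counts, with determinant \<open>a1 - a2\<close>. The solution
  depends on \<open>v\<close> only through its class, whence equitability.\<close>

lemma class_counts:
  "real (card (N v \<inter> V1)) * (a1 - a2) = \<theta>0 * \<alpha> $ v - a2 * real (valency G v)"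
  "real (card (N v \<inter> V2)) * (a1 - a2) = a1 * real (valency G v) - \<theta>0 * \<alpha> $ v"
proof -
  have "\<theta>0 * \<alpha> $ v = (\<Sum>w\<in>N v \<inter> V1. \<alpha> $ w) + (\<Sum>w\<in>N v \<inter> V2. \<alpha> $ w)"
    by (subst sum_alpha[symmetric]) (rule sum_split)
  also have "\<dots> = (\<Sum>w\<in>N v \<inter> V1. a1) + (\<Sum>w\<in>N v \<inter> V2. a2)"
    by (intro arg_cong2[where f="(+)"] sum.cong) (auto simp: alpha_V)
  finally have "\<theta>0 * \<alpha> $ v = a1 * real (card (N v \<inter> V1)) + a2 * real (card (N v \<inter> V2))"
    by (simp add: mult.commute)
  moreover have "real (valency G v) = real (card (N v \<inter> V1)) + real (card (N v \<inter> V2))"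
    unfolding valency_eq_card by (subst card_split) simp
  ultimately show
    "real (card (N v \<inter> V1)) * (a1 - a2) = \<theta>0 * \<alpha> $ v - a2 * real (valency G v)"
    "real (card (N v \<inter> V2)) * (a1 - a2) = a1 * real (valency G v) - \<theta>0 * \<alpha> $ v"
    by (simp_all add: algebra_simps)
qed

lemma class_count:
  "v \<in> V1 \<Longrightarrow> real (card (N v \<inter> V1)) = q11" "v \<in> V1 \<Longrightarrow> real (card (N v \<inter> V2)) = q12"
  "v \<in> V2 \<Longrightarrow> real (card (N v \<inter> V1)) = q21" "v \<in> V2 \<Longrightarrow> real (card (N v \<inter> V2)) = q22"
proof -
  have eq: "x = y" if "x * (a1 - a2) = y * (a1 - a2)" for x y using that a_less by simp
  show "real (card (N v \<inter> V1)) = q11" if "v \<in> V1"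
    by (rule eq, unfold class_counts q_mult) (simp add: that alpha_V valency_V algebra_simps)
  show "real (card (N v \<inter> V2)) = q12" if "v \<in> V1"
    by (rule eq, unfold class_counts q_mult) (simp add: that alpha_V valency_V algebra_simps)
  show "real (card (N v \<inter> V1)) = q21" if "v \<in> V2"
    by (rule eq, unfold class_counts q_mult) (simp add: that alpha_V valency_V algebra_simps)
  show "real (card (N v \<inter> V2)) = q22" if "v \<in> V2"
    by (rule eq, unfold class_counts q_mult) (simp add: that alpha_V valency_V algebra_simps)
qed

lemma average_count:
  "average_neighbours G V1 V1 = q11" "average_neighbours G V1 V2 = q12"
  "average_neighbours G V2 V1 = q21" "average_neighbours G V2 V2 = q22"
  using V_nonempty by (simp_all add: average_neighbours_def class_count)

lemma equitable: "equitable_partition G {V1, V2}"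
proof -
  have "partition_on (pverts G) {V1, V2}"
    by (simp add: partition_on_def disjoint_def verts V_Un V_disjoint Int_commute[of V2 V1]
        V_nonempty V_nonempty[symmetric])
  then show ?thesis by (simp add: equitable_partition_def average_count class_count)
qed

lemma q_Ints: "q11 \<in> \<int>" "q12 \<in> \<int>" "q21 \<in> \<int>" "q22 \<in> \<int>"
proof -
  obtain u v where uv: "u \<in> V1" "v \<in> V2" using V_nonempty by blast
  show "q11 \<in> \<int>" "q12 \<in> \<int>" "q21 \<in> \<int>" "q22 \<in> \<int>"
    by (simp_all flip: class_count(1,2)[OF uv(1)] class_count(3,4)[OF uv(2)])
qed

text \<open>Double counting of the edges between the classes.\<close>

lemma cross_count: "real n1 * q12 = real n2 * q21"
proof -
  have count: "real (card (N v \<inter> S)) = (\<Sum>w\<in>S. if (v, w) \<in> parcs G then 1 else 0)" for v S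
  proof -
    have "S \<inter> {w. (v, w) \<in> parcs G} = N v \<inter> S" by (auto simp: neighbours_iff)
    then show ?thesis by (simp add: sum.If_cases)
  qed
  have "real n1 * q12 = (\<Sum>v\<in>V1. real (card (N v \<inter> V2)))" by (simp add: n1 class_count)
  also have "\<dots> = (\<Sum>w\<in>V2. \<Sum>v\<in>V1. if (w, v) \<in> parcs G then 1 else 0)"
    unfolding count by (subst sum.swap) (intro sum.cong refl if_cong, rule adj_sym)
  also have "\<dots> = (\<Sum>v\<in>V2. real (card (N v \<inter> V1)))" unfolding count ..
  also have "\<dots> = real n2 * q21" by (simp add: n2 class_count)
  finally show ?thesis .
qed

text \<open>Otherwise \<open>V1\<close> would be closed under adjacency, against
  connectivity.\<close>

lemma cross_arc: obtains u v where "u \<in> V1" "v \<in> V2" "(u, v) \<in> parcs G"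
proof -
  obtain s t where s: "s \<in> V1" and t: "t \<in> V2" using V_nonempty by blast
  have "\<exists>u v. u \<in> V1 \<and> v \<in> V2 \<and> (u, v) \<in> parcs G"
  proof (rule ccontr)
    assume no: "\<not> ?thesis"
    have "v \<in> V1" if "u \<in> V1" "(u, v) \<in> parcs G" for u v
      using no that V_cases[of v] by blast
    then have "t \<in> V1" using s connected_induct[of "\<lambda>v. v \<in> V1" s t] by blast
    then show False using t V_cases[of t] by blast
  qed
  then show ?thesis using that by blast
qed

lemma q_cross_pos: "q12 > 0" "q21 > 0"
proof -
  obtain u v where uv: "u \<in> V1" "v \<in> V2" "(u, v) \<in> parcs G" by (rule cross_arc)
  then have "v \<in> N u \<inter> V2" "u \<in> N v \<inter> V1" by (auto simp: neighbours_iff adj_sym)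
  then have "card (N u \<inter> V2) > 0" "card (N v \<inter> V1) > 0" by (auto simp: card_gt_0_iff)
  then show "q12 > 0" "q21 > 0" by (simp_all flip: class_count(2)[OF uv(1)] class_count(3)[OF uv(2)])
qed

lemma valency_bounds: "real k1 > \<theta>0" "\<theta>0 > real k2"
  using q_cross_pos a_pos a_less by (auto simp: q12_def q21_def zero_less_mult_iff zero_less_divide_iff)

lemma theta0_pos: "\<theta>0 > 0" using valency_bounds(2) by linarith

text \<open>The second eigenvalue of the quotient matrix, and the eigenvalue of the graph that is
  not an eigenvalue of the quotient matrix.\<close>

definition "\<tau> = - \<theta>1 * \<theta>2 - a1 * a2"
definition "\<tau>' = \<theta>1 + \<theta>2 - \<tau>"

section \<open>Spectrum of the quotient matrix\<close>

lemma a_combination: "a1 * real k2 - a2 * real k1 = (a1 - a2) * \<tau>"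
proof -
  have "real k1 = a1\<^sup>2 - \<theta>1 * \<theta>2" "real k2 = a2\<^sup>2 - \<theta>1 * \<theta>2" using a_square by auto
  then show ?thesis unfolding \<tau>_def by algebra
qed

text \<open>The row sums of the quotient matrix \<open>Q\<close> are the valencies, so
  \<open>(real k1 - \<theta>0, real k2 - \<theta>0)\<close> is \<open>Q - \<theta>0\<close> applied
  to the all-one vector. By Cayley-Hamilton it must be an eigenvector for the other eigenvalue, if
  nonzero.\<close>

lemma quotient_eigenvector:
  "q11 * (real k1 - \<theta>0) - q12 * (\<theta>0 - real k2) = \<tau> * (real k1 - \<theta>0)"
  "q21 * (real k1 - \<theta>0) - q22 * (\<theta>0 - real k2) = - \<tau> * (\<theta>0 - real k2)"
proof -
  have eq: "x = y" if "x * (a1 - a2) = y * (a1 - a2)" for x y using that a_less by simp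
  have "(q11 * (real k1 - \<theta>0) - q12 * (\<theta>0 - real k2)) * (a1 - a2)
      = (q11 * (a1 - a2)) * (real k1 - \<theta>0) - (q12 * (a1 - a2)) * (\<theta>0 - real k2)"
    by (simp add: algebra_simps)
  also have "\<dots> = (a1 * real k2 - a2 * real k1) * (real k1 - \<theta>0)"
    unfolding q_mult by (simp add: algebra_simps)
  finally show "q11 * (real k1 - \<theta>0) - q12 * (\<theta>0 - real k2) = \<tau> * (real k1 - \<theta>0)"
    by - (rule eq, simp add: a_combination)
  have "(q21 * (real k1 - \<theta>0) - q22 * (\<theta>0 - real k2)) * (a1 - a2)
      = (q21 * (a1 - a2)) * (real k1 - \<theta>0) - (q22 * (a1 - a2)) * (\<theta>0 - real k2)"
    by (simp add: algebra_simps)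
  also have "\<dots> = - (a1 * real k2 - a2 * real k1) * (\<theta>0 - real k2)"
    unfolding q_mult by (simp add: algebra_simps)
  finally show "q21 * (real k1 - \<theta>0) - q22 * (\<theta>0 - real k2) = - \<tau> * (\<theta>0 - real k2)"
    by - (rule eq, simp add: a_combination)
qed

text \<open>Restates \<open>cross_count\<close> as orthogonality of \<open>\<alpha>\<close> to the
  eigenvector of \<open>quotient_eigenvector\<close>, extended constantly over the classes.\<close>

lemma weight_balance: "real n1 * a1 * (real k1 - \<theta>0) = real n2 * a2 * (\<theta>0 - real k2)"
proof -
  have "real n1 * (q12 * (a1 - a2)) = real n2 * (q21 * (a1 - a2))"
    using cross_count by (metis mult.assoc)
  then show ?thesis unfolding q_mult by (simp add: mult.assoc)
qed

lemma sum_class: "(\<Sum>v\<in>S. if v \<in> V1 then x else y) = real (card (S \<inter> V1)) * x + real (card (S \<inter> V2)) * y"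
  for x y :: real
proof -
  have "(\<Sum>v\<in>S \<inter> V2. if v \<in> V1 then x else y) = (\<Sum>v\<in>S \<inter> V2. y)"
    using V_disjoint by (intro sum.cong) auto
  then show ?thesis by (subst sum_split) simp
qed

text \<open>Equitability lifts the quotient eigenvector to an eigenvector \<open>w\<close> of
  \<open>A\<close>, constant on classes and orthogonal to \<open>\<alpha>\<close>.\<close>

lemma tau_mem: "\<tau> \<in> {\<theta>1, \<theta>2}"
proof (rule orthogonal_eigenvalue)
  define w :: "real^'a" where "w = (\<chi> v. if v \<in> V1 then real k1 - \<theta>0 else - (\<theta>0 - real k2))"
  have "(A *v w) $ v = (\<tau> *\<^sub>R w) $ v" for v
    using V_cases[of v] quotient_eigenvector
    by (auto simp: adjacency_matrix_mult_vector w_def sum_class class_count algebra_simps)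
  then show "A *v w = \<tau> *\<^sub>R w" by (simp add: vec_eq_iff)
  obtain s where "s \<in> V1" using V_nonempty by blast
  then have "w $ s \<noteq> 0" using valency_bounds by (simp add: w_def)
  then show "w \<noteq> 0" by (metis zero_index)
  have "\<alpha> \<bullet> w = (\<Sum>v\<in>UNIV. if v \<in> V1 then a1 * (real k1 - \<theta>0) else - a2 * (\<theta>0 - real k2))"
    unfolding inner_vec_def
  proof (intro sum.cong refl)
    fix v show "\<alpha> $ v \<bullet> w $ v = (if v \<in> V1 then a1 * (real k1 - \<theta>0) else - a2 * (\<theta>0 - real k2))"
      using V_cases[of v] by (auto simp: w_def alpha_V algebra_simps)
  qed
  then show "\<alpha> \<bullet> w = 0" using weight_balance by (simp add: sum_class n1 n2)
qed

lemma tau_pair: "{\<tau>, \<tau>'} = {\<theta>1, \<theta>2}" and tau_prod: "\<tau> * \<tau>' = \<theta>1 * \<theta>2"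
  and tau_sum: "\<tau> + \<tau>' = \<theta>1 + \<theta>2"
  and tau_less: "\<tau> < \<theta>0" "\<tau>' < \<theta>0"
  using tau_mem ord by (auto simp: \<tau>'_def)

lemma a_prod: "a1 * a2 = - \<tau> * (\<tau>' + 1)"
  using tau_prod by (simp add: \<tau>_def algebra_simps)

lemma quotient_trace: "q11 + q22 = \<theta>0 + \<tau>"
proof -
  have "(q11 + q22) * (a1 - a2) = (a1 - a2) * \<theta>0 + (a1 * real k2 - a2 * real k1)"
    unfolding distrib_right q_mult by (simp add: algebra_simps)
  also have "\<dots> = (\<theta>0 + \<tau>) * (a1 - a2)" unfolding a_combination by (simp add: algebra_simps)
  finally show ?thesis using a_less by simp
qed

text \<open>Shaped for the complete join: if \<open>q21 = real n1\<close>, then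
  \<open>a1 > a2\<close> pushes \<tau> below \<open>q11 - real n1\<close>.\<close>

lemma quotient_entries_tau: "\<tau> = q11 - q21 * a1 / a2"
proof -
  have "(q11 * a2 - q21 * a1) * (a1 - a2) = (q11 * (a1 - a2)) * a2 - (q21 * (a1 - a2)) * a1"
    by (simp add: algebra_simps)
  also have "\<dots> = (a1 * real k2 - a2 * real k1) * a2" unfolding q_mult by (simp add: algebra_simps)
  also have "\<dots> = (\<tau> * a2) * (a1 - a2)" by (simp add: a_combination)
  finally have "q11 * a2 - q21 * a1 = \<tau> * a2" using a_less by simp
  then show ?thesis using a_pos by (simp add: field_simps)
qed

text \<open>With \<open>quotient_trace\<close> this makes \<tau> a root of a monic quadratic with
  integer coefficients, and it yields the sign of \<tau> when a diagonal entry is zero.\<close>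

lemma quotient_det: "q11 * q22 - q12 * q21 = \<theta>0 * \<tau>"
proof -
  have q22: "q22 = \<theta>0 + \<tau> - q11" using quotient_trace by simp
  have "real k1 - \<theta>0 > 0" using valency_bounds by simp
  \<comment> \<open>First row of the statement that \<open>(a1, a2)\<close> is a
    \<theta>0-eigenvector of the quotient matrix.\<close>
  have "q12 * a2 = a1 * (\<theta>0 - q11)"
  proof -
    have "(q12 * a2) * (a1 - a2) = (q12 * (a1 - a2)) * a2" by (simp add: algebra_simps)
    also have "\<dots> = a1 * \<theta>0 * (a1 - a2) - a1 * (q11 * (a1 - a2))"
      unfolding q_mult by (simp add: algebra_simps)
    also have "\<dots> = (a1 * (\<theta>0 - q11)) * (a1 - a2)" by (simp add: algebra_simps)
    finally show ?thesis using a_less by simp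
  qed
  moreover have "q21 * a1 = a2 * (q11 - \<tau>)"
    using quotient_entries_tau a_pos by (simp add: field_simps)
  ultimately have "(q12 * q21) * (a1 * a2) = ((\<theta>0 - q11) * (q11 - \<tau>)) * (a1 * a2)"
    by algebra
  then have "q12 * q21 = (\<theta>0 - q11) * (q11 - \<tau>)" using a_pos by simp
  then show ?thesis unfolding q22 by (simp add: algebra_simps)
qed

section \<open>Class sizes and order\<close>

lemma theta_product: "(\<theta>0 - \<theta>1) * (\<theta>0 - \<theta>2) = (\<theta>0 - \<tau>) * (\<theta>0 - \<tau>')"
  using tau_mem by (auto simp: \<tau>'_def)

lemma weighted_size: "real n1 * a1\<^sup>2 + real n2 * a2\<^sup>2 = (\<theta>0 - \<tau>) * (\<theta>0 - \<tau>')"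
proof -
  have "\<alpha> \<bullet> \<alpha> = (\<Sum>v\<in>UNIV. if v \<in> V1 then a1\<^sup>2 else a2\<^sup>2)"
    unfolding inner_vec_def
  proof (intro sum.cong refl)
    fix v show "\<alpha> $ v \<bullet> \<alpha> $ v = (if v \<in> V1 then a1\<^sup>2 else a2\<^sup>2)"
      using V_cases[of v] by (auto simp: alpha_V power2_eq_square)
  qed
  then have "real n1 * a1\<^sup>2 + real n2 * a2\<^sup>2 = \<alpha> \<bullet> \<alpha>" by (simp add: sum_class n1 n2)
  also have "\<dots> = (\<theta>0 - \<tau>) * (\<theta>0 - \<tau>')"
    by (simp only: alpha_norm theta_product)
  finally show ?thesis .
qed

lemma theta0_minus_tau: "\<theta>0 + \<theta>1 * \<theta>2 + a1 * a2 = \<theta>0 - \<tau>" by (simp add: \<tau>_def)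

text \<open>\<open>weight_balance\<close> and \<open>weighted_size\<close> are linear equations for
  \<open>n1\<close> and \<open>n2\<close>; the factor \<open>\<theta>0 - \<tau>\<close> occurs in
  their determinant and in the norm of \<open>\<alpha>\<close> and cancels.\<close>

lemma class_sizes_mult:
  "real n1 * (a1 * (a1 - a2)) = (\<theta>0 - real k2) * (\<theta>0 - \<tau>')"
  "real n2 * (a2 * (a1 - a2)) = (real k1 - \<theta>0) * (\<theta>0 - \<tau>')"
proof -
  have den: "a1 * (\<theta>0 - real k2) + a2 * (real k1 - \<theta>0) = (a1 - a2) * (\<theta>0 - \<tau>)"
    using a_combination by (simp add: algebra_simps)
  have "(real n1 * a1) * (a1 * (\<theta>0 - real k2) + a2 * (real k1 - \<theta>0))
      = (real n1 * a1\<^sup>2 + real n2 * a2\<^sup>2) * (\<theta>0 - real k2)"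
    using weight_balance by algebra
  then have "(real n1 * (a1 * (a1 - a2))) * (\<theta>0 - \<tau>) = ((\<theta>0 - real k2) * (\<theta>0 - \<tau>')) * (\<theta>0 - \<tau>)"
    unfolding den weighted_size by algebra
  then show "real n1 * (a1 * (a1 - a2)) = (\<theta>0 - real k2) * (\<theta>0 - \<tau>')" using tau_less by simp
  have "(real n2 * a2) * (a1 * (\<theta>0 - real k2) + a2 * (real k1 - \<theta>0))
      = (real n1 * a1\<^sup>2 + real n2 * a2\<^sup>2) * (real k1 - \<theta>0)"
    using weight_balance by algebra
  then have "(real n2 * (a2 * (a1 - a2))) * (\<theta>0 - \<tau>) = ((real k1 - \<theta>0) * (\<theta>0 - \<tau>')) * (\<theta>0 - \<tau>)"
    unfolding den weighted_size by algebra
  then show "real n2 * (a2 * (a1 - a2)) = (real k1 - \<theta>0) * (\<theta>0 - \<tau>')" using tau_less by simp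
qed

text \<open>Reduces the complete join \<open>q21 = real n1\<close> to the numerical condition
  \<open>\<theta>0 - \<tau>' = a1 * a2\<close>.\<close>

lemma q21_ratio: "q21 * (\<theta>0 - \<tau>') = real n1 * (a1 * a2)"
proof -
  have "(q21 * (\<theta>0 - \<tau>')) * (a1 - a2) = (q21 * (a1 - a2)) * (\<theta>0 - \<tau>')" by simp
  also have "\<dots> = a2 * (real n1 * (a1 * (a1 - a2)))" unfolding q_mult class_sizes_mult by simp
  also have "\<dots> = (real n1 * (a1 * a2)) * (a1 - a2)" by simp
  finally show ?thesis using a_less by simp
qed

text \<open>Kept free of division, so that for prime order it becomes an identity between
  integers.\<close>

lemma order_mult:
  "real (card (pverts G)) * (a1 * a2) = (a1\<^sup>2 + a1 * a2 + a2\<^sup>2 - \<theta>0 - \<theta>1 * \<theta>2) * (\<theta>0 - \<tau>')"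
proof -
  have "(real (card (pverts G)) * (a1 * a2)) * (a1 - a2)
     = a2 * (real n1 * (a1 * (a1 - a2))) + a1 * (real n2 * (a2 * (a1 - a2)))"
    by (simp add: n_sum[symmetric] algebra_simps)
  also have "\<dots> = (a2 * (\<theta>0 - real k2) + a1 * (real k1 - \<theta>0)) * (\<theta>0 - \<tau>')"
    unfolding class_sizes_mult by (simp add: algebra_simps)
  also have "a2 * (\<theta>0 - real k2) + a1 * (real k1 - \<theta>0)
     = (a1\<^sup>2 + a1 * a2 + a2\<^sup>2 - \<theta>0 - \<theta>1 * \<theta>2) * (a1 - a2)"
  proof -
    have "real k1 = a1\<^sup>2 - \<theta>1 * \<theta>2" "real k2 = a2\<^sup>2 - \<theta>1 * \<theta>2" using a_square by auto
    then show ?thesis by algebra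
  qed
  finally show ?thesis using a_less by simp
qed

lemma order_formulas:
  "real (card (pverts G)) = ((a1\<^sup>2 + a1 * a2 + a2\<^sup>2 - \<theta>0 - \<theta>1 * \<theta>2) * (\<theta>0 - \<theta>1) * (\<theta>0 - \<theta>2)) /
     ((\<theta>0 + \<theta>1 * \<theta>2 + a1 * a2) * a1 * a2)"
  "real n1 = ((\<theta>0 - a2\<^sup>2 + \<theta>1 * \<theta>2) * (\<theta>0 - \<theta>1) * (\<theta>0 - \<theta>2)) /
     ((\<theta>0 + \<theta>1 * \<theta>2 + a1 * a2) * (a1 - a2) * a1)"
  "real n2 = ((a1\<^sup>2 - \<theta>0 - \<theta>1 * \<theta>2) * (\<theta>0 - \<theta>1) * (\<theta>0 - \<theta>2)) /
     ((\<theta>0 + \<theta>1 * \<theta>2 + a1 * a2) * (a1 - a2) * a2)"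
  unfolding theta0_minus_tau mult.assoc theta_product
  using order_mult class_sizes_mult a_pos a_less tau_less a_square
  by (simp_all add: eq_divide_eq mult.commute mult.left_commute)

lemma tau_quotient_eigenvalue: "\<tau> \<in> matrix_eigenvalues (quotient_matrix G V1 V2)"
proof -
  define f :: "real^2" where "f = vector [real k1 - \<theta>0, - (\<theta>0 - real k2)]"
  have "f $ 1 \<noteq> 0" using valency_bounds by (simp add: f_def)
  then have "f \<noteq> 0" by (metis zero_index)
  moreover have "quotient_matrix G V1 V2 *v f = \<tau> *\<^sub>R f"
    using quotient_eigenvector
    by (simp add: vec_eq_iff forall_2 matrix_vector_mult_def sum_2 quotient_matrix_def average_count f_def algebra_simps)
  ultimately show ?thesis by (auto simp: matrix_eigenvalues_def)
qed

lemma quotient_eigenvalue_cases: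
  assumes "matrix_eigenvalues (quotient_matrix G V1 V2) = {\<theta>0, \<theta>}"
  shows "\<exists>\<theta>'. {\<theta>, \<theta>'} = {\<theta>1, \<theta>2} \<and> a1 * a2 = - \<theta> * (\<theta>' + 1)"
proof -
  have "\<tau> = \<theta>" using tau_quotient_eigenvalue tau_less(1) assms by auto
  then show ?thesis using tau_pair a_prod by blast
qed

subsection \<open>Integrality\<close>

lemma common_neighbours_Ints:
  "(if (u, v) \<in> parcs G then \<theta>1 + \<theta>2 else 0) - (if u = v then \<theta>1 * \<theta>2 else 0) + \<alpha> $ u * \<alpha> $ v \<in> \<int>"
  unfolding common_neighbours[symmetric] by (rule Ints_of_nat)

lemma adjacent_Ints: "(u, v) \<in> parcs G \<Longrightarrow> \<theta>1 + \<theta>2 + \<alpha> $ u * \<alpha> $ v \<in> \<int>"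
  using common_neighbours_Ints[of u v] by (cases "u = v") (auto simp: adj_irrefl)

lemma nonadjacent_Ints: "(u, v) \<notin> parcs G \<Longrightarrow> u \<noteq> v \<Longrightarrow> \<alpha> $ u * \<alpha> $ v \<in> \<int>"
  using common_neighbours_Ints[of u v] by auto

lemma cross_adjacent_Ints: "\<theta>1 + \<theta>2 + a1 * a2 \<in> \<int>"
proof -
  obtain u v where uv: "u \<in> V1" "v \<in> V2" "(u, v) \<in> parcs G" by (rule cross_arc)
  show ?thesis using adjacent_Ints[OF uv(3)] by (simp add: alpha_V uv)
qed

lemma alpha_mult_self: "\<alpha> $ v * \<alpha> $ v = real (valency G v) + \<theta>1 * \<theta>2"
  using alpha_square[of v] by (simp add: power2_eq_square)

lemma alpha_eq_cases: "\<alpha> $ u = \<alpha> $ v \<or> {\<alpha> $ u, \<alpha> $ v} = {a1, a2}"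
  using V_cases[of u] V_cases[of v] alpha_V by auto

text \<open>A nonadjacent pair within a class has an integral common neighbour count equal to
  valency plus \<open>\<theta>1 * \<theta>2\<close>. Otherwise both classes are cliques: a
  nonadjacent pair across the classes makes \<open>a1 * a2\<close> and then
  \<open>\<theta>1 + \<theta>2\<close> integral, and an adjacent pair within a class gives the
  product.\<close>

lemma theta_prod_Ints: "\<theta>1 * \<theta>2 \<in> \<int>"
proof (cases "\<exists>u v. u \<noteq> v \<and> (u, v) \<notin> parcs G \<and> \<alpha> $ u = \<alpha> $ v")
  case True
  then obtain u v where "u \<noteq> v" "(u, v) \<notin> parcs G" "\<alpha> $ u = \<alpha> $ v" by blast
  then have "\<alpha> $ u * \<alpha> $ u \<in> \<int>" using nonadjacent_Ints[of u v] by simp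
  then have "real (valency G u) + \<theta>1 * \<theta>2 - real (valency G u) \<in> \<int>"
    unfolding alpha_mult_self by (rule Ints_diff) simp
  then show ?thesis by simp
next
  case clique: False
  \<comment> \<open>A complete graph would be regular.\<close>
  have "\<exists>u v. u \<noteq> v \<and> (u, v) \<notin> parcs G"
  proof (rule ccontr)
    assume "\<not> ?thesis"
    then have "u \<noteq> v \<Longrightarrow> (u, v) \<in> parcs G" for u v by blast
    then have "v \<in> N u \<longleftrightarrow> u \<noteq> v" for u v
      by (cases "u = v") (simp_all add: neighbours_iff adj_irrefl)
    then have "N u = UNIV - {u}" for u by blast
    then have "valency G u = card (UNIV :: 'a set) - 1" for u by (simp add: valency_eq_card)
    then show False using nonreg by (auto simp: regular_graph_def)
  qed
  then obtain u v where uv: "u \<noteq> v" "(u, v) \<notin> parcs G" by blast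
  then have "\<alpha> $ u \<noteq> \<alpha> $ v" using clique by blast
  then have "{\<alpha> $ u, \<alpha> $ v} = {a1, a2}" using alpha_eq_cases by blast
  then have "a1 * a2 = \<alpha> $ u * \<alpha> $ v" by (auto simp: doubleton_eq_iff mult.commute)
  then have "a1 * a2 \<in> \<int>" using nonadjacent_Ints[OF uv(2,1)] by simp
  with cross_adjacent_Ints have "\<theta>1 + \<theta>2 + a1 * a2 - a1 * a2 \<in> \<int>" by (rule Ints_diff)
  then have s: "\<theta>1 + \<theta>2 \<in> \<int>" by simp
  obtain x y where xy: "x \<in> V1" "y \<in> V2" "(x, y) \<in> parcs G" by (rule cross_arc)
  \<comment> \<open>With one vertex per class the graph would be the edge \<open>x y\<close>,
    leaving no room for the nonadjacent pair \<open>u\<close>, \<open>v\<close>.\<close>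
  have "\<exists>w z. w \<noteq> z \<and> \<alpha> $ w = \<alpha> $ z"
  proof (rule ccontr)
    assume no: "\<not> ?thesis"
    have "u \<in> {x, y}" "v \<in> {x, y}"
      using no alpha_V xy V_cases[of u] V_cases[of v] by (metis insertI1 insertI2)+
    then show False using uv xy(3) adj_sym[of x y] by auto
  qed
  then obtain w z where wz: "w \<noteq> z" "\<alpha> $ w = \<alpha> $ z" by blast
  then have "(w, z) \<in> parcs G" using clique by blast
  from adjacent_Ints[OF this] have "\<theta>1 + \<theta>2 + (real (valency G w) + \<theta>1 * \<theta>2) \<in> \<int>"
    by (simp only: wz(2)[symmetric] alpha_mult_self)
  then have "\<theta>1 + \<theta>2 + (real (valency G w) + \<theta>1 * \<theta>2) - (\<theta>1 + \<theta>2) - real (valency G w) \<in> \<int>"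
    using s by (intro Ints_diff) auto
  then show ?thesis by simp
qed

lemma tau'_Ints: "\<tau>' \<in> \<int>"
proof -
  have "\<tau>' = (\<theta>1 + \<theta>2 + a1 * a2) + \<theta>1 * \<theta>2" by (simp add: \<tau>'_def \<tau>_def)
  then show ?thesis using cross_adjacent_Ints theta_prod_Ints by simp
qed

text \<open>If every arc crossed between the classes, these would form a bipartition. The assumption
  \<open>nonbipartite\<close> enters here.\<close>

lemma no_class_arcs_absurd:
  assumes "\<And>u v. (u, v) \<in> parcs G \<Longrightarrow> \<alpha> $ u \<noteq> \<alpha> $ v"
  shows False
proof -
  have "\<forall>(u, v)\<in>parcs G. (u \<in> V1 \<and> v \<in> V2) \<or> (u \<in> V2 \<and> v \<in> V1)"
  proof clarify
    fix u v assume "(u, v) \<in> parcs G" "\<not> (u \<in> V2 \<and> v \<in> V1)"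
    then show "u \<in> V1 \<and> v \<in> V2" using assms[of u v] alpha_V V_cases[of u] V_cases[of v] by metis
  qed
  then have "\<exists>Y. V1 \<union> Y = pverts G \<and> V1 \<inter> Y = {} \<and>
      (\<forall>(u, v)\<in>parcs G. (u \<in> V1 \<and> v \<in> Y) \<or> (u \<in> Y \<and> v \<in> V1))"
    by (intro exI[of _ V2] conjI) (simp_all only: verts V_Un V_disjoint)
  then have "bipartite_graph G" unfolding bipartite_graph_def by (rule exI)
  then show False using nonbipartite by simp
qed

lemma zero_diagonal_absurd:
  assumes "q11 = 0" "q22 = 0"
  shows False
proof (rule no_class_arcs_absurd)
  fix u v assume uv: "(u, v) \<in> parcs G"
  have "v \<notin> V1" if "u \<in> V1"
    using class_count(1)[OF that] assms uv by (auto simp: neighbours_iff)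
  moreover have "v \<notin> V2" if "u \<in> V2"
    using class_count(4)[OF that] assms uv by (auto simp: neighbours_iff)
  ultimately show "\<alpha> $ u \<noteq> \<alpha> $ v"
    using V_cases[of u] V_cases[of v] a_less by (auto simp: alpha_V)
qed

text \<open>If \<open>\<tau>' \<noteq> 0\<close>, then \<tau> is the rational number
  \<open>\<theta>1 * \<theta>2 / \<tau>'\<close> and a root of the integral characteristic
  polynomial of the quotient matrix. If \<open>\<tau>' = 0\<close>, an arc within a class makes
  \<tau> plus a valency integral, so a non-integral \<tau> would leave no such arc.\<close>

lemma tau_Ints: "\<tau> \<in> \<int>"
proof (cases "\<tau>' = 0")
  case True
  then have p: "\<theta>1 * \<theta>2 = 0" and s: "\<theta>1 + \<theta>2 = \<tau>" using tau_prod tau_sum by auto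
  show ?thesis
  proof (rule ccontr)
    assume no: "\<tau> \<notin> \<int>"
    show False
    proof (rule no_class_arcs_absurd, rule notI)
      fix u v assume uv: "(u, v) \<in> parcs G" "\<alpha> $ u = \<alpha> $ v"
      have "\<tau> + real (valency G u) \<in> \<int>"
        using adjacent_Ints[OF uv(1)] alpha_mult_self[of u] p s uv(2) by simp
      then have "\<tau> + real (valency G u) - real (valency G u) \<in> \<int>" by (rule Ints_diff) simp
      then show False using no by simp
    qed
  qed
next
  case False
  then have "\<tau> = \<theta>1 * \<theta>2 / \<tau>'" using tau_prod by (simp add: field_simps)
  then have "\<tau> \<in> \<rat>" using theta_prod_Ints tau'_Ints Ints_subset_Rats by (auto intro: Rats_divide)
  moreover have "- (q11 + q22) \<in> \<int>" "q11 * q22 - q12 * q21 \<in> \<int>" using q_Ints by auto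
  moreover have "\<tau>\<^sup>2 + - (q11 + q22) * \<tau> + (q11 * q22 - q12 * q21) = 0"
    unfolding quotient_trace quotient_det by (simp add: algebra_simps power2_eq_square)
  ultimately show ?thesis by (rule Ints_monic_quadratic_root)
qed

lemma theta_Ints: "\<theta>0 \<in> \<int>" "\<theta>1 \<in> \<int>" "\<theta>2 \<in> \<int>"
proof -
  have "q11 + q22 - \<tau> \<in> \<int>" using q_Ints tau_Ints by simp
  then show "\<theta>0 \<in> \<int>" by (simp add: quotient_trace)
  show "\<theta>1 \<in> \<int>" "\<theta>2 \<in> \<int>" using tau_pair tau_Ints tau'_Ints by (auto simp: doubleton_eq_iff)
qed

lemma a_prod_Ints: "a1 * a2 \<in> \<int>"
  using tau_Ints tau'_Ints by (simp add: a_prod)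

lemma a_square_Ints: "a1\<^sup>2 \<in> \<int>" "a2\<^sup>2 \<in> \<int>"
  using theta_prod_Ints by (simp_all only: a_square Ints_add Ints_of_nat)

text \<open>If \<tau> were \<theta>1, integrality would give
  \<open>\<tau>' + 1 \<le> \<theta>1 < 0\<close>, against positivity of
  \<open>a1 * a2 = - \<tau> * (\<tau>' + 1)\<close>.\<close>

lemma tau_negative:
  assumes "\<tau> < 0"
  shows "\<tau> = \<theta>2" "\<tau>' = \<theta>1"
proof -
  have "\<tau> \<noteq> \<theta>1"
  proof
    assume 1: "\<tau> = \<theta>1"
    then have 2: "\<tau>' = \<theta>2" by (simp add: \<tau>'_def)
    have "\<theta>2 + 1 \<le> \<theta>1" using Ints_pos_ge_1[of "\<theta>1 - \<theta>2"] theta_Ints ord by simp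
    then have "- \<tau> * (\<tau>' + 1) \<le> 0" using assms 1 2 by (simp add: mult_nonpos_nonpos)
    then show False using a_prod a_pos by (metis mult_pos_pos not_less)
  qed
  then show "\<tau> = \<theta>2" using tau_mem by simp
  then show "\<tau>' = \<theta>1" by (simp add: \<tau>'_def)
qed

text \<open>A zero on the diagonal makes the determinant \<open>\<theta>0 * \<tau>\<close> of the
  quotient matrix negative.\<close>

lemma empty_class_a_prod:
  assumes "q11 = 0 \<or> q22 = 0"
  shows "a1 * a2 = - \<theta>2 * (\<theta>1 + 1)"
proof -
  have "\<theta>0 * \<tau> = - (q12 * q21)" using assms by (auto simp flip: quotient_det)
  also have "\<dots> < 0" using q_cross_pos by simp
  finally have "\<tau> < 0" using theta0_pos by (simp add: mult_less_0_iff)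
  then show ?thesis using tau_negative a_prod by simp
qed

section \<open>Complete joins, prime order and the final inequalities\<close>

lemma full_join_iff: "q21 = real n1 \<longleftrightarrow> q12 = real n2"
proof -
  have "q21 = real n1 \<longleftrightarrow> real n2 * q21 = real n2 * real n1" using n_pos by simp
  also have "\<dots> \<longleftrightarrow> real n1 * q12 = real n1 * real n2" by (simp only: cross_count mult.commute)
  also have "\<dots> \<longleftrightarrow> q12 = real n2" using n_pos by simp
  finally show ?thesis .
qed

lemma q_cross_le: "q21 \<le> real n1"
proof -
  obtain v where "v \<in> V2" using V_nonempty by blast
  then show ?thesis by (simp add: class_count(3)[symmetric] n1 card_mono)
qed

lemma full_join_adjacent:
  assumes "q12 = real n2" "u \<in> V1" "v \<in> V2"
  shows "(u, v) \<in> parcs G"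
proof -
  have "card (N u \<inter> V2) = card V2" using class_count(2)[OF assms(2)] assms(1) n2 by simp
  then have "N u \<inter> V2 = V2" by (intro card_subset_eq) auto
  then show ?thesis using assms(3) by (auto simp: neighbours_iff)
qed

lemma full_joinI:
  assumes "\<And>u v. u \<in> V1 \<Longrightarrow> v \<in> V2 \<Longrightarrow> (u, v) \<in> parcs G"
  shows "q12 = real n2"
proof -
  obtain u where u: "u \<in> V1" using V_nonempty by blast
  then have "N u \<inter> V2 = V2" using assms by (auto simp: neighbours_iff)
  then show ?thesis using class_count(2)[OF u] n2 by simp
qed

text \<open>In the integer identity \<open>n P = x d\<close> the prime \<open>n\<close> divides
  \<open>d\<close> or \<open>x\<close>. The former makes \<open>P\<close> a positive multiple of
  \<open>x\<close>, although \<open>x > P\<close>. The latter makes \<open>P\<close> a multiple of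
  \<open>d\<close>, so \<open>\<theta>0 - \<tau>' \<le> a1 * a2\<close>, and
  \<open>q21_ratio\<close> gives \<open>q21 \<ge> real n1\<close>.\<close>

lemma prime_order_full_join:
  assumes "prime (card (pverts G))"
  shows "q21 = real n1"
proof -
  let ?n = "card (pverts G)"
  define X where "X = a1\<^sup>2 + a1 * a2 + a2\<^sup>2 - \<theta>0 - \<theta>1 * \<theta>2"
  have X: "X = (real k1 - \<theta>0) + a2\<^sup>2 + a1 * a2" unfolding X_def by (simp add: a_square)
  have "X \<in> \<int>" "\<theta>0 - \<tau>' \<in> \<int>"
    unfolding X_def using a_square_Ints a_prod_Ints theta_Ints tau'_Ints by auto
  with a_prod_Ints obtain P x d where
    P: "a1 * a2 = of_int P" and x: "X = of_int x" and d: "\<theta>0 - \<tau>' = of_int d"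
    by (metis Ints_cases)
  have P_pos: "P > 0" using a_pos P by (metis mult_pos_pos of_int_0_less_iff)
  have d_pos: "d > 0" using tau_less d by simp
  have "real_of_int (int ?n * P) = real_of_int (x * d)"
    using order_mult by (simp flip: P x d X_def)
  then have eq: "int ?n * P = x * d" by (simp only: of_int_eq_iff)
  have "a2\<^sup>2 > 0" using a_pos by simp
  then have "X > a1 * a2" using X valency_bounds by linarith
  then have xP: "x > P" using P x by simp
  have "prime (int ?n)" using assms by simp
  moreover have "int ?n dvd x * d" using eq by (metis dvd_triv_left)
  ultimately consider "int ?n dvd d" | "int ?n dvd x" by (auto simp: prime_dvd_mult_iff)
  then show ?thesis
  proof cases
    case 1
    then obtain c where c: "d = int ?n * c" by blast
    have "c \<ge> 1" using d_pos c by (metis int_one_le_iff_zero_less mult_pos_pos of_nat_0_le_iff zero_less_mult_pos not_less mult_nonneg_nonpos)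
    moreover have "P = x * c" using eq c assms by (simp add: prime_gt_0_nat)
    ultimately have "P \<ge> x" using xP P_pos by simp
    then show ?thesis using xP by simp
  next
    case 2
    then obtain c where c: "x = int ?n * c" by blast
    have "x > 0" using xP P_pos by simp
    then have "c \<ge> 1" using c by (metis int_one_le_iff_zero_less of_nat_0_le_iff not_less mult_nonneg_nonpos)
    moreover have "P = c * d" using eq c assms by (simp add: prime_gt_0_nat)
    ultimately have "d \<le> P" using d_pos by simp
    then have "\<theta>0 - \<tau>' \<le> a1 * a2" by (simp add: P d)
    then have "real n1 * (\<theta>0 - \<tau>') \<le> real n1 * (a1 * a2)" by (simp add: mult_left_mono)
    also have "\<dots> = q21 * (\<theta>0 - \<tau>')" by (simp add: q21_ratio)
    finally have "real n1 \<le> q21" using tau_less by simp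
    then show ?thesis using q_cross_le by simp
  qed
qed

text \<open>Both \<open>a2\<close> and \<open>a1 - a2\<close> are positive with integral squares,
  hence at least 1; the claim is the expansion of
  \<open>(a2 - 1) * (a1 - a2 - 1) \<ge> 0\<close>.\<close>

lemma a_difference_lower: "a1 - 1 \<le> (a1 - a2) * a2"
proof -
  have "(a1 - a2)\<^sup>2 = a1\<^sup>2 + a2\<^sup>2 - 2 * (a1 * a2)" by (simp add: power2_eq_square algebra_simps)
  then have "(a1 - a2)\<^sup>2 \<in> \<int>" using a_square_Ints a_prod_Ints by simp
  then have "1\<^sup>2 \<le> (a1 - a2)\<^sup>2" using a_less by (simp add: Ints_pos_ge_1)
  then have 1: "1 \<le> a1 - a2" by (rule power2_le_imp_le) (use a_less in simp)
  have "1\<^sup>2 \<le> a2\<^sup>2" using a_square_Ints(2) a_pos by (simp add: Ints_pos_ge_1)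
  then have 2: "1 \<le> a2" by (rule power2_le_imp_le) (use a_pos in simp)
  have "0 \<le> (a2 - 1) * (a1 - a2 - 1)" using 1 2 by simp
  then show ?thesis by (simp add: algebra_simps)
qed

text \<open>Common neighbours of \<open>u\<close> in \<open>V1\<close> and \<open>v\<close> in
  \<open>V2\<close> number at most \<open>k2\<close>, and at most \<open>k2 - 1\<close> if adjacent,
  since \<open>u\<close> is then a neighbour of \<open>v\<close> but not of itself. An adjacent pair
  gives the first bound; a nonadjacent pair, present because the join is incomplete, gives the
  second.\<close>

lemma a_difference_upper:
  assumes "q12 \<noteq> real n2"
  shows "(a1 - a2) * a2 \<le> min (- (\<theta>1 + 1) * (\<theta>2 + 1)) (- \<theta>1 * \<theta>2)"
proof -
  have *: "(a1 - a2) * a2 = a1 * a2 - real k2 - \<theta>1 * \<theta>2"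
    using a_square(2) by (simp add: algebra_simps power2_eq_square)
  obtain u v where uv: "u \<in> V1" "v \<in> V2" "(u, v) \<in> parcs G" by (rule cross_arc)
  have "u \<noteq> v" using uv V_disjoint by blast
  have "u \<in> N v - N u" using uv adj_irrefl adj_sym by (auto simp: neighbours_iff)
  then have "card (N u \<inter> N v) < card (N v)" by (intro psubset_card_mono) auto
  then have "\<theta>1 + \<theta>2 + a1 * a2 + 1 \<le> real k2"
    using common_neighbours[of u v] uv \<open>u \<noteq> v\<close>
    by (auto simp: alpha_V valency_V simp flip: valency_eq_card)
  moreover obtain x y where xy: "x \<in> V1" "y \<in> V2" "(x, y) \<notin> parcs G" using assms full_joinI by blast
  have "card (N x \<inter> N y) \<le> card (N y)" by (intro card_mono) auto
  then have "a1 * a2 \<le> real k2"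
    using common_neighbours[of x y] xy V_disjoint
    by (auto simp: alpha_V valency_V simp flip: valency_eq_card split: if_splits)
  ultimately show ?thesis unfolding * by (simp add: algebra_simps)
qed

subsection \<open>Complete joins and cones\<close>

lemma q11_less: "q11 + 1 \<le> real n1"
proof -
  obtain x where x: "x \<in> V1" using V_nonempty by blast
  have "x \<notin> N x" by (simp add: neighbours_iff adj_irrefl)
  then have "card (N x \<inter> V1) < card V1" using x by (intro psubset_card_mono) auto
  then show ?thesis using class_count(1)[OF x] n1 by simp
qed

text \<open>Otherwise \<open>- \<theta>2 - 1\<close> would be an eigenvalue of the complement of the graph induced on \<open>V1\<close>,
  although it exceeds the valency \<open>n1 - 1 - q11\<close> of that complement.\<close>

lemma class_eigenvector_zero:
  assumes g: "A *v g = \<theta>2 *\<^sub>R g" and supp: "\<And>v. v \<in> V2 \<Longrightarrow> g $ v = 0"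
    and sum0: "(\<Sum>v\<in>V1. g $ v) = 0" and less: "\<theta>2 < q11 - real n1"
  shows "g = 0"
proof (rule ccontr)
  assume "g \<noteq> 0"
  define m where "m = Max (range (\<lambda>v. \<bar>g $ v\<bar>))"
  have "m \<in> range (\<lambda>v. \<bar>g $ v\<bar>)" unfolding m_def by (intro Max_in) auto
  then obtain u where u: "m = \<bar>g $ u\<bar>" by blast
  have max: "\<bar>g $ v\<bar> \<le> \<bar>g $ u\<bar>" for v unfolding u[symmetric] m_def by (intro Max_ge) auto
  have "\<bar>g $ u\<bar> \<noteq> 0"
  proof
    assume "\<bar>g $ u\<bar> = 0"
    then have "g $ v = 0" for v using max[of v] by simp
    then show False using \<open>g \<noteq> 0\<close> by (simp add: vec_eq_iff)
  qed
  then have pos: "\<bar>g $ u\<bar> > 0" by simp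
  then have uV: "u \<in> V1" using supp[of u] V_cases[of u] by auto
  have "\<theta>2 * g $ u = (\<Sum>v\<in>N u. g $ v)"
    using arg_cong[OF g, of "\<lambda>x. x $ u"] by (simp add: adjacency_matrix_mult_vector)
  also have "\<dots> = (\<Sum>v\<in>N u \<inter> V1. g $ v)"
    by (subst sum_split) (simp add: supp)
  \<comment> \<open>Passes to the complement within \<open>V1\<close>, using that \<open>g\<close>
    sums to zero there. Splitting off \<open>u\<close> itself turns \<theta>2 into
    \<open>\<theta>2 + 1\<close>.\<close>
  also have "\<dots> = - (\<Sum>v\<in>V1 - N u. g $ v)"
    using sum.Int_Diff[of V1 "\<lambda>v. g $ v" "N u"] sum0 by (simp add: Int_commute)
  also have "(\<Sum>v\<in>V1 - N u. g $ v) = g $ u + (\<Sum>v\<in>V1 - N u - {u}. g $ v)"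
    using uV adj_irrefl[of u] by (intro sum.remove) (auto simp: neighbours_iff)
  finally have "\<bar>(\<theta>2 + 1) * g $ u\<bar> = \<bar>\<Sum>v\<in>V1 - N u - {u}. g $ v\<bar>" by (simp add: algebra_simps)
  also have "\<dots> \<le> (\<Sum>v\<in>V1 - N u - {u}. \<bar>g $ v\<bar>)" by (rule sum_abs)
  also have "\<dots> \<le> real (card (V1 - N u - {u})) * \<bar>g $ u\<bar>" by (rule sum_bounded_above) (rule max)
  also have "real (card (V1 - N u - {u})) = real n1 - q11 - 1"
  proof -
    have "card V1 = card (V1 \<inter> N u) + card (V1 - N u)" by (intro card_Int_Diff) simp
    moreover have "u \<in> V1 - N u" using uV adj_irrefl[of u] by (simp add: neighbours_iff)
    then have "card (V1 - N u) = Suc (card (V1 - N u - {u}))" by (intro card.remove) auto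
    ultimately show ?thesis using class_count(1)[OF uV] n1 by (simp add: Int_commute)
  qed
  finally have "\<bar>\<theta>2 + 1\<bar> \<le> real n1 - q11 - 1" using pos by (simp add: abs_mult)
  then show False using less by linarith
qed

text \<open>The difference \<open>f\<close> of the unit vectors at \<open>x\<close> and
  \<open>y\<close> is orthogonal to \<open>\<alpha>\<close>, so \<open>g\<close> satisfies the
  \<theta>2-eigenvalue equation. It vanishes on \<open>V2\<close> by the join and sums to zero on
  \<open>V1\<close> by constant column sums, hence is zero; its entry at \<open>x\<close> is
  \<open>- A $ x $ y - \<theta>1\<close>.\<close>

lemma full_join_class_arcs:
  assumes join: "q12 = real n2" and less: "\<theta>2 < q11 - real n1"
    and xy: "x \<in> V1" "y \<in> V1" "x \<noteq> y"
  shows "A $ x $ y = - \<theta>1"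
proof -
  define f :: "real^'a" where "f = axis x 1 - axis y 1"
  define g where "g = A *v f - \<theta>1 *\<^sub>R f"
  have f: "f $ z = (if z = x then 1 else 0) - (if z = y then 1 else 0)" for z
    by (auto simp: f_def axis_def)
  have Af: "(A *v f) $ z = A $ z $ x - A $ z $ y" for z
    by (simp add: f_def matrix_vector_mult_diff_distrib matrix_vector_mult_basis column_def)
  have "\<alpha> \<bullet> f = 0" using xy by (simp add: f_def inner_diff_right inner_axis alpha_V)
  then have "A *v (A *v f) = (\<theta>1 + \<theta>2) *\<^sub>R (A *v f) - (\<theta>1 * \<theta>2) *\<^sub>R f"
    using B_mult_vector[of f] B_vec[of f] by (simp add: algebra_simps)
  then have "A *v g = \<theta>2 *\<^sub>R g"
    by (simp add: g_def matrix_vector_mult_diff_distrib matrix_vector_mult_scaleR algebra_simps)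
  moreover have "g $ v = 0" if "v \<in> V2" for v
  proof -
    have "(v, x) \<in> parcs G" "(v, y) \<in> parcs G"
      using full_join_adjacent[OF join] that xy adj_sym by blast+
    moreover have "v \<noteq> x" "v \<noteq> y" using that xy V_disjoint by blast+
    ultimately show ?thesis by (simp add: g_def Af f adjacency_matrix_nth)
  qed
  moreover have "(\<Sum>v\<in>V1. g $ v) = 0"
  proof -
    have col: "(\<Sum>v\<in>V1. A $ v $ z) = q11" if "z \<in> V1" for z
    proof -
      have "V1 \<inter> {v. (v, z) \<in> parcs G} = N z \<inter> V1" using adj_sym by (auto simp: neighbours_iff)
      then show ?thesis using class_count(1)[OF that] by (simp add: adjacency_matrix_nth sum.If_cases)
    qed
    have "(\<Sum>v\<in>V1. f $ v) = 0" using xy by (simp add: f sum_subtractf)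
    moreover have "(\<Sum>v\<in>V1. g $ v) = (\<Sum>v\<in>V1. A $ v $ x) - (\<Sum>v\<in>V1. A $ v $ y) - \<theta>1 * (\<Sum>v\<in>V1. f $ v)"
      by (simp add: g_def Af sum_subtractf sum_distrib_left)
    ultimately show ?thesis using col xy by simp
  qed
  ultimately have "g = 0" using less by (rule class_eigenvector_zero)
  then have "g $ x = 0" by simp
  then show ?thesis using xy(3) by (simp add: g_def Af f adjacency_matrix_nth adj_irrefl)
qed

text \<open>With two vertices in \<open>V1\<close>, all pairs there have the same adjacency
  \<open>- \<theta>1\<close>. A clique has \<open>\<theta>1 = - 1\<close>, so
  \<open>a1 * a2 = 0\<close>. An empty class has \<open>\<theta>1 = 0\<close>, so
  \<open>\<theta>0 = a1 * a2 = - \<tau>\<close>, and the trace leaves a quotient matrix with zero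
  diagonal.\<close>

lemma full_join_imp_singleton:
  assumes join: "q12 = real n2"
  shows "n1 = 1"
proof (rule ccontr)
  assume "n1 \<noteq> 1"
  then have "\<not> card V1 \<le> Suc 0" using n_pos n1 by simp
  then obtain x y where xy: "x \<in> V1" "y \<in> V1" "x \<noteq> y" by (auto simp: card_le_Suc0_iff_eq)
  have q21: "q21 = real n1" using full_join_iff join by simp
  have "real n1 * a2 < real n1 * a1" using n_pos a_less by simp
  then have "real n1 < real n1 * a1 / a2" using a_pos by (simp add: field_simps)
  then have \<tau>_less: "\<tau> < q11 - real n1" unfolding quotient_entries_tau q21 by simp
  then have "\<tau> < 0" using q11_less by simp
  note \<tau> = tau_negative[OF this]
  have arcs: "A $ u $ v = - \<theta>1" if "u \<in> V1" "v \<in> V1" "u \<noteq> v" for u v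
    using full_join_class_arcs[OF join _ that] \<tau>_less \<tau> by simp
  have "\<theta>1 \<noteq> - 1" using a_prod a_pos \<tau> by (metis add.left_inverse mult_pos_pos mult_zero_right less_irrefl)
  then have 0: "\<theta>1 = 0" using arcs[OF xy] by (simp add: adjacency_matrix_nth split: if_splits)
  have "N x \<inter> V1 = {}"
    using arcs[OF xy(1)] adj_irrefl[of x] 0 by (force simp: neighbours_iff adjacency_matrix_nth)
  then have q11: "q11 = 0" using class_count(1)[OF xy(1)] by simp
  have "real n1 * (\<theta>0 - \<tau>') = real n1 * (a1 * a2)" using q21_ratio q21 by simp
  then have "\<theta>0 = a1 * a2" using n_pos \<tau> 0 by simp
  then have "\<theta>0 + \<tau> = 0" using a_prod \<tau> 0 by simp
  then have "q22 = 0" using quotient_trace q11 by simp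
  with q11 show False by (rule zero_diagonal_absurd)
qed

section \<open>Singleton classes and cones\<close>

lemma singleton_imp_full_join:
  assumes "n1 = 1"
  shows "q12 = real n2"
proof -
  \<comment> \<open>\<open>q21\<close> is a positive integer bounded by
    \<open>n1 = 1\<close>.\<close>
  have "q21 = real n1"
    using assms q_cross_le Ints_pos_ge_1[OF q_Ints(3) q_cross_pos(2)] by simp
  then show ?thesis by (simp add: full_join_iff)
qed

text \<open>Ensures that nonadjacent vertices of \<open>V2\<close> have a common neighbour besides
  the apex. If \<open>a2 = 1\<close>, then \<open>\<tau> = - a1\<close> and
  \<open>\<theta>0 = a1\<close>, so the trace vanishes and the graph would be bipartite.\<close>

lemma singleton_a2_gt_1:
  assumes "n1 = 1" "q11 = 0"
  shows "a2\<^sup>2 > 1"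
proof (rule ccontr)
  assume "\<not> ?thesis"
  then have "a2\<^sup>2 = 1\<^sup>2" using Ints_pos_ge_1[OF a_square_Ints(2)] a_pos by simp
  then have a2: "a2 = 1" using a_pos by (simp only: power2_eq_iff_nonneg less_imp_le zero_le_one)
  have "q21 = 1" using singleton_imp_full_join[OF assms(1)] full_join_iff assms(1) by simp
  then have \<tau>: "\<tau> = - a1" using quotient_entries_tau assms(2) a2 by simp
  then have p: "\<theta>1 * \<theta>2 = 0" using a2 by (simp add: \<tau>_def)
  have "a1 * \<theta>0 = real k1" using q_mult(1) assms(2) a2 by simp
  also have "\<dots> = a1 * a1" using a_square(1) p by (simp add: power2_eq_square)
  finally have "\<theta>0 = a1" using a_pos by simp
  then have "q22 = 0" using quotient_trace \<tau> assms(2) by simp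
  with assms(2) show False by (rule zero_diagonal_absurd)
qed

text \<open>The apex \<open>c\<close> is a common neighbour of every pair in \<open>V2\<close>, so
  counts inside \<open>H\<close> are those of \<open>G\<close> minus one and depend only on
  adjacency. Connectivity holds because nonadjacent vertices have \<open>a2\<^sup>2 - 1 > 0\<close>
  common neighbours.\<close>

lemma singleton_imp_cone:
  assumes 1: "n1 = 1"
  shows "cone_over_strongly_regular G"
proof -
  obtain c where c: "V1 = {c}" using 1 n1 by (auto simp: card_1_singleton_iff)
  define H where "H = \<lparr>pverts = V2, parcs = parcs G \<inter> V2 \<times> V2\<rparr>"
  have join: "(c, v) \<in> parcs G" "(v, c) \<in> parcs G" if "v \<in> V2" for v
    using full_join_adjacent[OF singleton_imp_full_join[OF 1]] that c adj_sym by blast+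
  have H: "pair_graph H"
    by (rule pair_graphI) (auto simp: H_def adj_irrefl adj_sym)
  have nH: "neighbours H u = N u \<inter> V2" if "u \<in> V2" for u
    using that by (auto simp: H_def neighbours_def)
  have common: "real (card (neighbours H u \<inter> neighbours H v)) =
      (if (u, v) \<in> parcs G then \<theta>1 + \<theta>2 else 0) + a2\<^sup>2 - 1" if "u \<in> V2" "v \<in> V2" "u \<noteq> v" for u v
  proof -
    have "N u \<inter> N v \<inter> V1 = {c}" using join that c by (auto simp: neighbours_iff)
    then have "card (N u \<inter> N v) = 1 + card (N u \<inter> N v \<inter> V2)" using card_split[of "N u \<inter> N v"] by simp
    moreover have "neighbours H u \<inter> neighbours H v = N u \<inter> N v \<inter> V2" using that nH by blast
    ultimately show ?thesis
      using common_neighbours[of u v] that by (auto simp: alpha_V power2_eq_square)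
  qed
  have "q11 = 0" using class_count(1)[of c] c adj_irrefl[of c] by (simp add: neighbours_def)
  then have a2: "a2\<^sup>2 > 1" using singleton_a2_gt_1 1 by simp
  interpret H: pair_graph H by (rule H)
  have arcH: "reachable (with_proj H) u v" if "u \<in> V2" "v \<in> V2" "(u, v) \<in> parcs G" for u v
    using that by (intro H.reachable_adjI) (simp add: H_def)
  have "reachable (with_proj H) u v" if uv: "u \<in> V2" "v \<in> V2" for u v
  proof (cases "u = v \<or> (u, v) \<in> parcs G")
    case True
    then show ?thesis using arcH uv H.reachable_refl[of u] by (auto simp: H_def)
  next
    case False
    then have "card (neighbours H u \<inter> neighbours H v) \<noteq> 0" using common[of u v] uv a2 by auto
    then obtain w where "w \<in> neighbours H u \<inter> neighbours H v" by (metis card.empty ex_in_conv)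
    then have w: "w \<in> V2" "(u, w) \<in> parcs G" "(w, v) \<in> parcs G"
      using uv nH adj_sym by (auto simp: neighbours_iff)
    show ?thesis using arcH[OF uv(1) w(1,2)] arcH[OF w(1) uv(2) w(3)] by (rule H.reachable_trans)
  qed
  then have conn: "graph_connected H"
    using V_nonempty unfolding graph_connected_iff[OF H] by (simp add: H_def)
  \<comment> \<open>Converts the real formulas for the counts into the natural constants that
    regularity and strong regularity ask for.\<close>
  have nat: "k = nat \<lfloor>x\<rfloor>" if "real k = x" for k x using that by auto
  have "valency H u = nat \<lfloor>q22\<rfloor>" if "u \<in> V2" for u
    using that by (intro nat) (simp add: valency_eq_card nH class_count)
  then have reg: "regular_graph H" by (auto simp: regular_graph_def H_def)
  have "card (neighbours H u \<inter> neighbours H v) =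
      (if (u, v) \<in> parcs H then nat \<lfloor>\<theta>1 + \<theta>2 + a2\<^sup>2 - 1\<rfloor> else nat \<lfloor>a2\<^sup>2 - 1\<rfloor>)"
    if "u \<in> pverts H" "v \<in> pverts H" "u \<noteq> v" for u v
    using nat[OF common[of u v]] that by (auto simp: H_def)
  then have "strongly_regular H"
    unfolding strongly_regular_def using H conn reg by blast
  moreover have "c \<notin> pverts H" using c V_disjoint by (auto simp: H_def)
  moreover have "G = cone c H"
  proof (rule pair_pre_digraph.equality)
    show "pverts G = pverts (cone c H)" using V_Un c by (simp add: cone_def H_def verts)
    show "parcs G = parcs (cone c H)"
    proof (rule set_eqI, clarify)
      fix u v
      have "u \<in> V2 \<longleftrightarrow> u \<noteq> c" "v \<in> V2 \<longleftrightarrow> v \<noteq> c" using V_cases[of u] V_cases[of v] c by auto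
      then show "(u, v) \<in> parcs G \<longleftrightarrow> (u, v) \<in> parcs (cone c H)"
        using join adj_irrefl[of c] by (auto simp: cone_def H_def)
    qed
  qed simp
  ultimately show ?thesis unfolding cone_over_strongly_regular_def by blast
qed

text \<open>The apex has valency \<open>card (pverts H)\<close>, every other vertex has
  \<open>Suc r\<close>, which is at most that. As there are two valencies, the apex alone carries
  the larger.\<close>

lemma cone_imp_singleton:
  assumes "cone_over_strongly_regular G"
  shows "n1 = 1"
proof -
  obtain c H where sr: "strongly_regular H" and c: "c \<notin> pverts H" and G: "G = cone c H"
    using assms unfolding cone_over_strongly_regular_def by blast
  have H: "pair_graph H" using sr by (simp add: strongly_regular_def)
  obtain r where r: "\<And>u. u \<in> pverts H \<Longrightarrow> valency H u = r"
    using sr by (auto simp: strongly_regular_def regular_graph_def)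
  have vertsH: "insert c (pverts H) = UNIV" using verts G by (simp add: cone_def)
  have "pverts H \<noteq> {}" using sr H graph_connected_iff by (auto simp: strongly_regular_def)
  then obtain h where h: "h \<in> pverts H" by blast
  have inH: "neighbours H u \<subseteq> pverts H" for u
    using pair_graph_in_verts[OF H] by (auto simp: neighbours_def)
  have "N c = pverts H"
    using c pair_graph_in_verts[OF H] by (auto simp: G cone_def neighbours_def)
  then have val_c: "valency G c = card (pverts H)" by (simp add: valency_eq_card)
  have val: "valency G u = Suc r" if "u \<in> pverts H" for u
  proof -
    have "N u = insert c (neighbours H u)"
      using that c pair_graph_in_verts[OF H] by (auto simp: G cone_def neighbours_def)
    moreover have "c \<notin> neighbours H u" using inH c by blast
    ultimately show ?thesis using r[OF that] by (simp add: valency_eq_card)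
  qed
  have "neighbours H h \<subseteq> pverts H - {h}"
    using inH[of h] pair_graph_irrefl[OF H, of h] by (auto simp: neighbours_iff)
  then have "card (neighbours H h) \<le> card (pverts H - {h})" by (intro card_mono) auto
  moreover have "card (pverts H) > 0" using h by (auto simp: card_gt_0_iff)
  ultimately have "Suc r \<le> card (pverts H)" using r[OF h] h by (simp add: valency_eq_card)
  moreover have "{k1, k2} = {card (pverts H), Suc r}"
  proof -
    have "{k1, k2} = valency G ` insert c (pverts H)" by (simp only: valencies vertsH)
    also have "\<dots> = {card (pverts H), Suc r}" using val_c val h by auto
    finally show ?thesis .
  qed
  ultimately have k: "k1 = card (pverts H)" "k2 = Suc r" using k_less by (auto simp: doubleton_eq_iff)
  have "v \<in> V1 \<longleftrightarrow> v = c" for v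
  proof (cases "v = c")
    case False
    then have "v \<in> pverts H" using vertsH by blast
    then show ?thesis using val[of v] k k_less False by (simp add: valency_class_def)
  qed (simp add: valency_class_def verts val_c k)
  then have "V1 = {c}" by blast
  then show ?thesis by (simp add: n1)
qed

end

theorem theorem4p3:
  fixes \<Gamma> :: "'v::finite pair_pre_digraph"
    and \<theta>0 \<theta>1 \<theta>2 \<alpha>1 \<alpha>2 k11 k12 k21 k22 :: real
    and n n1 n2 k1 k2 :: nat
    and V1 V2 :: "'v set"
    and Q :: "real^2^2"
  assumes "\<theta>0 > \<theta>1" and "\<theta>1 > \<theta>2"
    and "\<Gamma> \<in> three_eigenvalue_graphs \<theta>0 \<theta>1 \<theta>2"
    and "\<not> bipartite_graph \<Gamma>"
    and "biregular_with_array \<Gamma> n1 n2 k1 k2"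
    and "n = card (pverts \<Gamma>)"
    and "V1 = valency_class \<Gamma> k1" and "V2 = valency_class \<Gamma> k2"
    and "\<alpha>1 = alpha_entry \<Gamma> \<theta>1 \<theta>2 k1" and "\<alpha>2 = alpha_entry \<Gamma> \<theta>1 \<theta>2 k2"
    and "Q = quotient_matrix \<Gamma> V1 V2"
    and "k11 = Q $ 1 $ 1" and "k12 = Q $ 1 $ 2" and "k21 = Q $ 2 $ 1" and "k22 = Q $ 2 $ 2"
  shows
    "(equitable_partition \<Gamma> {V1, V2} \<and>
      k11 = (\<alpha>1 * \<theta>0 - \<alpha>2 * real k1) / (\<alpha>1 - \<alpha>2) \<and>
      k12 = \<alpha>1 * ((real k1 - \<theta>0) / (\<alpha>1 - \<alpha>2)) \<and>
      k21 = \<alpha>2 * ((\<theta>0 - real k2) / (\<alpha>1 - \<alpha>2)) \<and>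
      k22 = (\<alpha>1 * real k2 - \<alpha>2 * \<theta>0) / (\<alpha>1 - \<alpha>2)) \<and>
     graph_eigenvalues \<Gamma> \<subseteq> \<int> \<and>
     (\<forall>\<theta>. matrix_eigenvalues Q = {\<theta>0, \<theta>} \<longrightarrow>
        (\<exists>\<theta>'. {\<theta>, \<theta>'} = {\<theta>1, \<theta>2} \<and> \<alpha>1 * \<alpha>2 = - \<theta> * (\<theta>' + 1))) \<and>
     (k11 = 0 \<or> k22 = 0 \<longrightarrow> \<alpha>1 * \<alpha>2 = - \<theta>2 * (\<theta>1 + 1)) \<and>
     (real n = ((\<alpha>1\<^sup>2 + \<alpha>1 * \<alpha>2 + \<alpha>2\<^sup>2 - \<theta>0 - \<theta>1 * \<theta>2) * (\<theta>0 - \<theta>1) * (\<theta>0 - \<theta>2)) /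
               ((\<theta>0 + \<theta>1 * \<theta>2 + \<alpha>1 * \<alpha>2) * \<alpha>1 * \<alpha>2) \<and>
      real n1 = ((\<theta>0 - \<alpha>2\<^sup>2 + \<theta>1 * \<theta>2) * (\<theta>0 - \<theta>1) * (\<theta>0 - \<theta>2)) /
                ((\<theta>0 + \<theta>1 * \<theta>2 + \<alpha>1 * \<alpha>2) * (\<alpha>1 - \<alpha>2) * \<alpha>1) \<and>
      real n2 = ((\<alpha>1\<^sup>2 - \<theta>0 - \<theta>1 * \<theta>2) * (\<theta>0 - \<theta>1) * (\<theta>0 - \<theta>2)) /
                ((\<theta>0 + \<theta>1 * \<theta>2 + \<alpha>1 * \<alpha>2) * (\<alpha>1 - \<alpha>2) * \<alpha>2)) \<and>
     ((k21 = real n1 \<longleftrightarrow> k12 = real n2) \<and>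
      (k12 = real n2 \<longleftrightarrow> n1 = 1) \<and>
      (n1 = 1 \<longleftrightarrow> cone_over_strongly_regular \<Gamma>)) \<and>
     (prime n \<and> n \<ge> 3 \<longrightarrow> cone_over_strongly_regular \<Gamma>) \<and>
     (\<not> cone_over_strongly_regular \<Gamma> \<longrightarrow>
        \<alpha>1 - 1 \<le> (\<alpha>1 - \<alpha>2) * \<alpha>2 \<and>
        (\<alpha>1 - \<alpha>2) * \<alpha>2 \<le> min (- (\<theta>1 + 1) * (\<theta>2 + 1)) (- \<theta>1 * \<theta>2))"
proof -
  interpret biregular_three_eigenvalue_graph \<Gamma> \<theta>0 \<theta>1 \<theta>2 n1 n2 k1 k2
    using assms(1-5) by unfold_locales
  have k: "k11 = q11" "k12 = q12" "k21 = q21" "k22 = q22"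
    unfolding assms(7-15) quotient_matrix_def average_count by simp_all
  note sizes = assms(6,9,10)
  have cone: "q12 = real n2 \<longleftrightarrow> n1 = 1" "n1 = 1 \<longleftrightarrow> cone_over_strongly_regular \<Gamma>"
    using full_join_imp_singleton singleton_imp_full_join singleton_imp_cone cone_imp_singleton by blast+
  have "equitable_partition \<Gamma> {V1, V2}" unfolding assms(7,8) by (rule equitable)
  moreover have "graph_eigenvalues \<Gamma> \<subseteq> \<int>"
    using theta_Ints evs by (simp add: graph_eigenvalues_def)
  moreover have "\<forall>\<theta>. matrix_eigenvalues Q = {\<theta>0, \<theta>} \<longrightarrow>
        (\<exists>\<theta>'. {\<theta>, \<theta>'} = {\<theta>1, \<theta>2} \<and> \<alpha>1 * \<alpha>2 = - \<theta> * (\<theta>' + 1))"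
    unfolding assms(7-11) using quotient_eigenvalue_cases by blast
  moreover have "prime n \<and> n \<ge> 3 \<longrightarrow> cone_over_strongly_regular \<Gamma>"
    unfolding assms(6) using prime_order_full_join full_join_iff cone by blast
  moreover have "\<not> cone_over_strongly_regular \<Gamma> \<longrightarrow>
        \<alpha>1 - 1 \<le> (\<alpha>1 - \<alpha>2) * \<alpha>2 \<and>
        (\<alpha>1 - \<alpha>2) * \<alpha>2 \<le> min (- (\<theta>1 + 1) * (\<theta>2 + 1)) (- \<theta>1 * \<theta>2)"
    unfolding sizes using a_difference_lower a_difference_upper cone by blast
  moreover have "k11 = 0 \<or> k22 = 0 \<longrightarrow> \<alpha>1 * \<alpha>2 = - \<theta>2 * (\<theta>1 + 1)"
    unfolding k sizes using empty_class_a_prod by blast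
  moreover note order_formulas[folded sizes] full_join_iff[folded k] cone[folded k]
    q11_def[folded sizes k] q12_def[folded sizes k] q21_def[folded sizes k] q22_def[folded sizes k]
  ultimately show ?thesis by (intro conjI) assumption+
qed

end
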